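(* Let $r\ge1$ be an integer. The number of subgroup classes of abelian groups of rank less than or equal to $r$ and order at most $x$ is asymptotic, as $x\to\infty$, to $C_r\,x\log x$, where $C_r$ is a constant depending on $r$. That is, there is a constant $C_r$ with $$\sum_{n\le x}A_r(n)\sim C_r\,x\log x\qquad (x\to\infty).$$
   Context: For a finite abelian group $G$, the number of subgroup classes of $G$ is the number of isomorphism classes of groups $H$ that are isomorphic to a subgroup of $G$ (isomorphic subgroups are counted once). $A_r(n)$ is the sum, over isomorphism classes of abelian groups $G$ of order $n$ and rank at most $r$ (rank = minimal number of generators), of the number of subgroup classes of $G$. *)

theory Defs
  imports "HOL-Algebra.Algebra" "HOL-Library.Landau_Symbols" Complex_Main
begin

definition group_rank :: "('a, 'b) monoid_scheme \<Rightarrow> nat" where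
  "group_rank G =
    (LEAST k. \<exists>S. S \<subseteq> carrier G \<and> finite S \<and> card S = k \<and> generate G S = carrier G)"

text \<open>
  Every finite group has a copy whose carrier is a set of natural numbers, so isomorphism
  classes of finite groups are represented by classes of groups of type \<^typ>\<open>nat monoid\<close>.
  The relation is restricted to groups because \<open>\<cong>\<close> alone says nothing about the
  \<open>one\<close> field of the records.
\<close>

definition group_iso_rel :: "nat monoid rel" where
  "group_iso_rel = {(G, H). group G \<and> group H \<and> G \<cong> H}"

definition num_subgroup_classes :: "('a, 'b) monoid_scheme \<Rightarrow> nat" where
  "num_subgroup_classes G =
    card ({H. group H \<and> (\<exists>K. subgroup K G \<and> H \<cong> G\<lparr>carrier := K\<rparr>)} // group_iso_rel)"

definition abelian_classes :: "nat \<Rightarrow> nat \<Rightarrow> nat monoid set set" where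
  "abelian_classes r n =
    {G. comm_group G \<and> finite (carrier G) \<and> order G = n \<and> group_rank G \<le> r} // group_iso_rel"

text \<open>
  The summand does not depend on the chosen representative:
  see \<open>num_subgroup_classes_cong\<close> below.
\<close>

definition subgroup_class_total :: "nat \<Rightarrow> nat \<Rightarrow> nat" where
  "subgroup_class_total r n = (\<Sum>c\<in>abelian_classes r n. num_subgroup_classes (SOME G. G \<in> c))"

lemma equiv_group_iso_rel: "equiv {G. group G} group_iso_rel"
  unfolding group_iso_rel_def
  by (rule equivI)
     (auto intro!: refl_onI symI transI intro: iso_refl group.iso_sym iso_trans)

lemma iso_subgroup_image:
  assumes "group G" "group H" "h \<in> iso G H" "subgroup K G"
  shows "subgroup (h ` K) H" "G\<lparr>carrier := K\<rparr> \<cong> H\<lparr>carrier := h ` K\<rparr>"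
proof -
  interpret group_hom G H h
    using assms by (simp add: group_hom_def group_hom_axioms_def iso_def)
  show "subgroup (h ` K) H"
    using assms(4) by (rule subgroup_img_is_subgroup)
  have "K \<subseteq> carrier G"
    using assms(4) by (rule subgroup.subset)
  then have "h \<in> iso (G\<lparr>carrier := K\<rparr>) (H\<lparr>carrier := h ` K\<rparr>)"
    using assms(3) by (auto simp: iso_def hom_def bij_betw_def inj_on_def subset_iff)
  then show "G\<lparr>carrier := K\<rparr> \<cong> H\<lparr>carrier := h ` K\<rparr>"
    by (auto simp: is_iso_def)
qed

lemma iso_to_subgroup_transfer:
  assumes "group G" "group H" "G \<cong> H" "\<exists>K. subgroup K G \<and> M \<cong> G\<lparr>carrier := K\<rparr>"
  shows "\<exists>K. subgroup K H \<and> M \<cong> H\<lparr>carrier := K\<rparr>"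
proof -
  obtain h where h: "h \<in> iso G H"
    using assms(3) by (auto simp: is_iso_def)
  obtain K where K: "subgroup K G" "M \<cong> G\<lparr>carrier := K\<rparr>"
    using assms(4) by blast
  show ?thesis
    using iso_subgroup_image[OF assms(1,2) h K(1)] K(2) iso_trans by blast
qed

lemma num_subgroup_classes_cong:
  assumes "group G" "group H" "G \<cong> H"
  shows "num_subgroup_classes G = num_subgroup_classes H"
proof -
  have "H \<cong> G"
    using assms by (simp add: group.iso_sym)
  then have "(\<exists>K. subgroup K G \<and> M \<cong> G\<lparr>carrier := K\<rparr>) \<longleftrightarrow>
             (\<exists>K. subgroup K H \<and> M \<cong> H\<lparr>carrier := K\<rparr>)" for M :: "nat monoid"
    using iso_to_subgroup_transfer[of G H M] iso_to_subgroup_transfer[of H G M] assms by blast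
  then show ?thesis
    by (simp add: num_subgroup_classes_def)
qed

end

theory Submission
  imports Defs "HOL-Analysis.Analysis" "HOL-Real_Asymp.Real_Asymp"
begin

text \<open>
  \<open>A\<^sub>r(n)\<close> is the number of pairs of isomorphism classes of \<open>G\<close> and of a subgroup of
  \<open>G\<close>, with \<open>G\<close> abelian of order \<open>n\<close> and rank at most \<open>r\<close>. Splitting \<open>G\<close> into
  torsion parts makes \<open>A\<^sub>r\<close> multiplicative. Since a group of rank at most \<open>r\<close> is a product of
  \<open>r\<close> cyclic groups, and the rank does not increase in subgroups, \<open>A\<^sub>r(n) \<le> d(n)\<^sup>2\<^sup>r\<close>, with
  \<open>d\<close> the number of divisors; cyclic groups give \<open>A\<^sub>r(n) \<ge> d(n)\<close>, and \<open>A\<^sub>r(p) = 2\<close> for primes \<open>p\<close>.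
  Hence \<open>A\<^sub>r = 1 * 1 * h\<close> (Dirichlet convolution) with \<open>h\<close> multiplicative and \<open>h(p) = 0\<close>, so
  that the sum of \<open>|h(m)| / m\<close> converges. Dirichlet's \<open>d(1) + \<dots> + d(N) \<sim> N log N\<close> and dominated
  convergence give the asymptotics with constant \<open>C\<^sub>r = \<Sum> h(m) / m\<close>, and \<open>A\<^sub>r \<ge> d\<close> gives \<open>C\<^sub>r \<ge> 1\<close>.
\<close>

hide_const (open) Divisibility.prime Polynomial.order

section \<open>Summatory functions of multiplicative functions\<close>

text \<open>For the upper bound it is enough that the orders of \<open>r\<close> independent
  generators determine a group. At prime powers the bound is polynomial in the exponent and uniform
  in the prime; together with \<open>h(p) = 0\<close> this is what makes the Euler factors converge.
  The delicate point is multiplicativity, because a pair of classes does not remember how the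
  subgroup sits in \<open>G\<close>. Two facts settle it: coprime factors can be recovered from the
  isomorphism type of their product (injections in both directions between finite groups), and a
  subgroup splits along the torsion parts of \<open>G\<close>. The bound \<open>C_r >= 1\<close>
  does real work: \<open>\<sim>\<close> with constant 0 would say that the sums vanish eventually,
  so the limit of the quotient yields the asymptotics only for a nonzero constant.\<close>

definition multiplicative :: "(nat \<Rightarrow> real) \<Rightarrow> bool" where
  "multiplicative f \<longleftrightarrow> f 1 = 1 \<and> (\<forall>m n. m > 0 \<longrightarrow> n > 0 \<longrightarrow> coprime m n \<longrightarrow> f (m * n) = f m * f n)"

text \<open>For multiplicative \<open>f\<close> this is the Dirichlet convolution of \<open>f\<close> with the Moebius function.\<close>

definition delta :: "(nat \<Rightarrow> real) \<Rightarrow> nat \<Rightarrow> real" where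
  "delta f n = (\<Prod>p\<in>prime_factors n. f (p ^ multiplicity p n) - f (p ^ (multiplicity p n - 1)))"

lemma multiplicativeD:
  "multiplicative f \<Longrightarrow> m > 0 \<Longrightarrow> n > 0 \<Longrightarrow> coprime m n \<Longrightarrow> f (m * n) = f m * f n"
  by (simp add: multiplicative_def)

lemma delta_prime_power:
  assumes "prime p" "k > 0"
  shows "delta f (p ^ k) = f (p ^ k) - f (p ^ (k - 1))"
  using assms by (simp add: delta_def prime_factorization_prime_power)

text \<open>The defining product splits along the disjoint prime factors of coprime arguments. So
  \<open>delta f\<close> is multiplicative by construction, and \<open>delta\<close> can be applied
  a second time.\<close>

lemma multiplicative_delta: "multiplicative (delta f)"
  unfolding multiplicative_def
proof (intro conjI allI impI)
  show "delta f 1 = 1" by (simp add: delta_def)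
  fix m n :: nat assume *: "m > 0" "n > 0" "coprime m n"
  have disj: "prime_factors m \<inter> prime_factors n = {}"
    using * by (meson Int_emptyI coprime_common_divisor in_prime_factors_iff not_prime_unit)
  have m: "multiplicity p (m * n) = multiplicity p m" if "p \<in> prime_factors m" for p
  proof -
    have "p \<notin> prime_factors n" using disj that by auto
    then have "multiplicity p n = 0"
      using that * by (auto simp: in_prime_factors_iff not_dvd_imp_multiplicity_0)
    then show ?thesis
      using that * by (subst prime_elem_multiplicity_mult_distrib) (auto simp: in_prime_factors_iff)
  qed
  have n: "multiplicity p (m * n) = multiplicity p n" if "p \<in> prime_factors n" for p
  proof -
    have "p \<notin> prime_factors m" using disj that by auto
    then have "multiplicity p m = 0"
      using that * by (auto simp: in_prime_factors_iff not_dvd_imp_multiplicity_0)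
    then show ?thesis
      using that * by (subst prime_elem_multiplicity_mult_distrib) (auto simp: in_prime_factors_iff)
  qed
  have "prime_factors (m * n) = prime_factors m \<union> prime_factors n"
    using * by (simp add: prime_factors_product)
  then show "delta f (m * n) = delta f m * delta f n"
    unfolding delta_def using disj m n by (simp add: prod.union_disjoint)
qed

text \<open>Unique factorization: \<open>i\<close> is recovered as the multiplicity of
  \<open>p\<close>. The reindexing splits a divisor sum off one prime at a time.\<close>

lemma bij_betw_divisors_prime_power_mult:
  assumes "prime p" "m > (0::nat)" "\<not> p dvd m"
  shows "bij_betw (\<lambda>(i, e). p ^ i * e) ({..k} \<times> {e. e dvd m}) {d. d dvd p ^ k * m}"
proof (rule bij_betw_imageI)
  have npe: "\<not> p dvd e" if "e dvd m" for e using that assms by auto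
  have mult: "multiplicity p (p ^ i * e) = i" if "e dvd m" for i e
    using npe[OF that] assms that
    by (intro multiplicity_eqI) (auto simp: prime_gt_0_nat)
  show "inj_on (\<lambda>(i, e). p ^ i * e) ({..k} \<times> {e. e dvd m})"
  proof (rule inj_onI, clarsimp)
    fix i e j e' assume *: "e dvd m" "e' dvd m" "p ^ i * e = p ^ j * e'"
    then have "i = j" using mult[of e i] mult[of e' j] by simp
    then show "i = j \<and> e = e'" using * assms(1) by (simp add: prime_gt_0_nat)
  qed
  show "(\<lambda>(i, e). p ^ i * e) ` ({..k} \<times> {e. e dvd m}) = {d. d dvd p ^ k * m}"
  proof (intro equalityI subsetI)
    fix d assume "d \<in> (\<lambda>(i, e). p ^ i * e) ` ({..k} \<times> {e. e dvd m})"
    then show "d \<in> {d. d dvd p ^ k * m}" by (auto intro!: mult_dvd_mono le_imp_power_dvd)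
  next
    fix d assume "d \<in> {d. d dvd p ^ k * m}"
    then obtain x y where xy: "d = x * y" "x dvd p ^ k" "y dvd m"
      by (auto elim: dvd_productE)
    then obtain i where "i \<le> k" "x = p ^ i" using assms(1) by (auto simp: divides_primepow_nat)
    then show "d \<in> (\<lambda>(i, e). p ^ i * e) ` ({..k} \<times> {e. e dvd m})" using xy by auto
  qed
qed

lemma prime_power_decomposition:
  assumes "prime p" "n > (0::nat)"
  obtains m where "n = p ^ multiplicity p n * m" "m > 0" "\<not> p dvd m" "coprime p m"
proof -
  from assms obtain m where m: "n = p ^ multiplicity p n * m" "\<not> p dvd m"
    using multiplicity_decompose'[of n p] by (metis not_gr_zero not_prime_unit mult.commute)
  with assms that show ?thesis by (metis gr_zeroI mult_0_right prime_imp_coprime)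
qed

text \<open>Moebius inversion. With the full power of one prime \<open>p\<close> split off, the
  divisor sum factors; the sum over the powers of \<open>p\<close> telescopes, and the cofactor
  \<open>m\<close> is smaller than \<open>n\<close>, so induction applies to it.\<close>

lemma sum_delta:
  assumes "multiplicative f" "n > 0"
  shows "(\<Sum>d | d dvd n. delta f d) = f n"
  using assms(2)
proof (induction n rule: less_induct)
  case (less n)
  show ?case
  proof (cases "n = 1")
    case True
    then show ?thesis using assms(1) by (simp add: delta_def multiplicative_def)
  next
    case False
    then obtain p where p: "prime p" "p dvd n" using prime_factor_nat by blast
    define k where "k = multiplicity p n"
    obtain m where m: "n = p ^ k * m" "m > 0" "\<not> p dvd m" "coprime p m"
      using prime_power_decomposition[OF p(1) less.prems] unfolding k_def by metis
    have k: "k > 0" using p m by (cases k) auto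
    have "p ^ k > 1" using one_less_power[OF prime_gt_1_nat[OF p(1)] k] .
    then have "m < n" using m by simp
    then have IH: "(\<Sum>d | d dvd m. delta f d) = f m" using less.IH m(2) by simp
    have tele: "(\<Sum>i\<le>j. delta f (p ^ i)) = f (p ^ j)" for j
    proof (induction j)
      case 0 then show ?case using assms(1) by (simp add: delta_def multiplicative_def)
    next
      case (Suc j) then show ?case using delta_prime_power[OF p(1), of "Suc j" f] by simp
    qed
    have "(\<Sum>d | d dvd n. delta f d) = (\<Sum>(i,e)\<in>{..k} \<times> {e. e dvd m}. delta f (p ^ i * e))"
      unfolding m(1) using sum.reindex_bij_betw[OF bij_betw_divisors_prime_power_mult[OF p(1) m(2,3), of k], of "delta f"]
      by (simp add: case_prod_unfold)
    also have "\<dots> = (\<Sum>(i,e)\<in>{..k} \<times> {e. e dvd m}. delta f (p ^ i) * delta f e)"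
    proof (intro sum.cong refl, clarify)
      fix i e assume "e dvd m"
      then have "coprime (p ^ i) e" using m(4) by (meson coprime_divisors coprime_power_left_iff dvd_refl)
      then show "delta f (p ^ i * e) = delta f (p ^ i) * delta f e"
        using \<open>e dvd m\<close> m(2) p(1)
        by (intro multiplicativeD[OF multiplicative_delta]) (auto simp: prime_gt_0_nat intro: Nat.gr0I)
    qed
    also have "\<dots> = (\<Sum>i\<le>k. delta f (p ^ i)) * (\<Sum>e | e dvd m. delta f e)"
      by (simp add: sum_product sum.cartesian_product)
    also have "\<dots> = f n"
      using m p(1) unfolding tele IH by (simp add: multiplicativeD[OF assms(1)] prime_gt_0_nat)
    finally show ?thesis .
  qed
qed

text \<open>Double counting of the pairs \<open>(d, e)\<close> with \<open>d * e <= N\<close>. The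
  weight \<open>F\<close> makes the step iterable: a first application leaves the factor
  \<open>N div d\<close>, which becomes the weight of the second.\<close>

lemma sum_upto_divisors:
  fixes f F :: "nat \<Rightarrow> real"
  shows "(\<Sum>n=1..N. (\<Sum>d | d dvd n. f d) * F n) = (\<Sum>d=1..N. f d * (\<Sum>e=1..N div d. F (d * e)))"
proof -
  have "(\<Sum>n=1..N. (\<Sum>d | d dvd n. f d) * F n) = (\<Sum>n=1..N. \<Sum>d\<in>{d\<in>{1..N}. d dvd n}. f d * F n)"
    by (intro sum.cong refl, subst sum_distrib_right, rule sum.cong)
      (auto dest: dvd_imp_le intro: Nat.gr0I)
  also have "\<dots> = (\<Sum>n=1..N. \<Sum>d=1..N. if d dvd n then f d * F n else 0)"
    by (subst sum.inter_filter) simp_all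
  also have "\<dots> = (\<Sum>d=1..N. \<Sum>n=1..N. if d dvd n then f d * F n else 0)" by (rule sum.swap)
  also have "\<dots> = (\<Sum>d=1..N. f d * (\<Sum>e=1..N div d. F (d * e)))"
  proof (intro sum.cong refl)
    fix d assume d: "d \<in> {1..N}"
    have "bij_betw (\<lambda>k. d * k) {1..N div d} {n\<in>{1..N}. d dvd n}"
    proof (intro bij_betwI[where g = "\<lambda>n. n div d"])
      show "(\<lambda>k. d * k) \<in> {1..N div d} \<rightarrow> {n\<in>{1..N}. d dvd n}"
        using d less_eq_div_iff_mult_less_eq[of d _ N] by (auto simp: mult.commute)
      show "(\<lambda>n. n div d) \<in> {n\<in>{1..N}. d dvd n} \<rightarrow> {1..N div d}"
      proof
        fix n assume "n \<in> {n\<in>{1..N}. d dvd n}"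
        then obtain k where k: "n = d * k" "1 \<le> n" "n \<le> N" by (auto elim: dvdE)
        then have "k \<ge> 1" by (cases k) auto
        moreover have "k \<le> N div d" using d k div_le_mono[of n N d] by simp
        ultimately show "n div d \<in> {1..N div d}" using d k by simp
      qed
    qed (use d in auto)
    then have "(\<Sum>e=1..N div d. f d * F (d * e)) = (\<Sum>n\<in>{n\<in>{1..N}. d dvd n}. f d * F n)"
      by (rule sum.reindex_bij_betw)
    then show "(\<Sum>n=1..N. if d dvd n then f d * F n else 0) = f d * (\<Sum>e=1..N div d. F (d * e))"
      by (subst sum.inter_filter[symmetric]) (auto simp: sum_distrib_left)
  qed
  finally show ?thesis .
qed

text \<open>Dirichlet's lattice point count of the pairs \<open>(d, e)\<close> with
  \<open>d * e <= N\<close>, that is, \<open>d(1) + ... + d(N)\<close> by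
  \<open>sum_card_divisors\<close>.\<close>

definition divisor_sum :: "nat \<Rightarrow> real" where
  "divisor_sum N = (\<Sum>e=1..N. real (N div e))"

lemma sum_upto_multiplicative:
  assumes "multiplicative a"
  shows "(\<Sum>n=1..N. a n) = (\<Sum>m=1..N. delta (delta a) m * divisor_sum (N div m))"
proof -
  have "(\<Sum>n=1..N. a n) = (\<Sum>n=1..N. (\<Sum>d | d dvd n. delta a d) * 1)"
    by (simp add: sum_delta assms)
  also have "\<dots> = (\<Sum>d=1..N. (\<Sum>m | m dvd d. delta (delta a) m) * real (N div d))"
    by (subst sum_upto_divisors) (simp add: sum_delta multiplicative_delta)
  also have "\<dots> = (\<Sum>m=1..N. delta (delta a) m * divisor_sum (N div m))"
    by (subst sum_upto_divisors) (simp add: divisor_sum_def div_mult2_eq)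
  finally show ?thesis .
qed

lemma sum_card_divisors: "(\<Sum>n=1..N. real (card {d. d dvd n})) = divisor_sum N"
  using sum_upto_divisors[of "\<lambda>_. 1" "\<lambda>_. 1" N] by (simp add: divisor_sum_def)

text \<open>A finite Euler product bound. Splitting off the power of \<open>p\<close> embeds
  \<open>S\<close> into a grid of exponents and cofactors; as \<open>w\<close> is nonnegative, the
  sum over the whole grid, which factors, is an upper bound.\<close>

lemma sum_prime_factors_le_prod:
  fixes w :: "nat \<Rightarrow> real"
  assumes w: "multiplicative w" "\<And>n. w n \<ge> 0"
    and b: "\<And>p L. prime p \<Longrightarrow> (\<Sum>k\<le>L. w (p ^ k)) \<le> b p"
    and "finite P" "\<And>p. p \<in> P \<Longrightarrow> prime p"
  shows "finite S \<Longrightarrow> (\<And>n. n \<in> S \<Longrightarrow> n > 0 \<and> prime_factors n \<subseteq> P) \<Longrightarrow> (\<Sum>n\<in>S. w n) \<le> (\<Prod>p\<in>P. b p)"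
  using assms(4,5)
proof (induction P arbitrary: S rule: finite_induct)
  case empty
  have "S \<subseteq> {1}" using empty(2) by (auto simp: prime_factorization_empty_iff)
  then have "(\<Sum>n\<in>S. w n) \<le> (\<Sum>n\<in>{1}. w n)" using w by (intro sum_mono2) auto
  then show ?case using w by (simp add: multiplicative_def)
next
  case (insert p P)
  have p: "prime p" using insert.prems by auto
  define g where "g n = (multiplicity p n, n div p ^ multiplicity p n)" for n
  define L where "L = Max (multiplicity p ` S)"
  define S' where "S' = (\<lambda>n. n div p ^ multiplicity p n) ` S"
  have dec: "n = p ^ multiplicity p n * (n div p ^ multiplicity p n)" for n
    by (simp add: multiplicity_dvd)
  have cop: "coprime p (n div p ^ multiplicity p n) \<and> n div p ^ multiplicity p n > 0" if "n \<in> S" for n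
  proof -
    have n: "n > 0" using insert.prems that by auto
    obtain m where m: "n = p ^ multiplicity p n * m" "m > 0" "\<not> p dvd m" "coprime p m"
      using prime_power_decomposition[OF p n] by metis
    then have "n div p ^ multiplicity p n = m" using p
      by (metis nonzero_mult_div_cancel_left not_prime_0 power_not_zero)
    with m show ?thesis by simp
  qed
  have "(\<Sum>n\<in>S. w n) = (\<Sum>n\<in>S. w (p ^ fst (g n)) * w (snd (g n)))"
  proof (intro sum.cong refl)
    fix n assume n: "n \<in> S"
    have "w n = w (p ^ multiplicity p n * (n div p ^ multiplicity p n))" using dec by simp
    also have "\<dots> = w (p ^ multiplicity p n) * w (n div p ^ multiplicity p n)"
      using cop[OF n] p by (intro multiplicativeD[OF w(1)]) (auto simp: prime_gt_0_nat)
    finally show "w n = w (p ^ fst (g n)) * w (snd (g n))" by (simp add: g_def)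
  qed
  also have "\<dots> = (\<Sum>(k,m)\<in>g ` S. w (p ^ k) * w m)"
  proof (subst sum.reindex)
    show "inj_on g S" by (rule inj_onI) (metis dec g_def prod.inject)
  qed (auto simp: case_prod_unfold)
  also have "\<dots> \<le> (\<Sum>(k,m)\<in>{..L} \<times> S'. w (p ^ k) * w m)"
    using insert.prems w(2) by (intro sum_mono2) (auto simp: g_def L_def S'_def)
  also have "\<dots> = (\<Sum>k\<le>L. w (p ^ k)) * (\<Sum>m\<in>S'. w m)"
    by (simp add: sum_product sum.cartesian_product)
  also have "\<dots> \<le> b p * (\<Prod>p\<in>P. b p)"
  proof (intro mult_mono)
    show "(\<Sum>m\<in>S'. w m) \<le> (\<Prod>p\<in>P. b p)"
    proof (rule insert.IH)
      show "finite S'" using insert.prems by (simp add: S'_def)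
      fix m assume "m \<in> S'"
      then obtain n where n: "n \<in> S" "m = n div p ^ multiplicity p n" by (auto simp: S'_def)
      have "n > 0" "prime_factors n \<subseteq> insert p P" using insert.prems n by auto
      moreover have "m dvd n" using dec[of n] n by (metis dvd_triv_right)
      moreover have "p \<notin> prime_factors m" using cop[OF n(1)] n p by (auto simp: in_prime_factors_iff)
      ultimately show "m > 0 \<and> prime_factors m \<subseteq> P"
        using cop[OF n(1)] n(2) dvd_prime_factors[of n m] by auto
    qed (use insert.prems in auto)
    show "b p \<ge> 0" using b[OF p, of 0] w(2)[of "1"] by simp
  qed (use b[OF p] w in \<open>auto intro!: sum_nonneg\<close>)
  also have "\<dots> = (\<Prod>p\<in>insert p P. b p)" using insert.hyps by simp
  finally show ?case .
qed

section \<open>Growth of the summatory divisor function\<close>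

lemma divide_minus_one_le_of_nat_div: "real n / real d - 1 \<le> real (n div d)"
proof (cases "d = 0")
  case False
  then have "real n \<le> real (n div d * d + d)"
    using mod_less_divisor[of d n] div_mult_mod_eq[of n d] by (intro of_nat_mono) linarith
  with False show ?thesis by (simp add: field_simps)
qed simp

text \<open>Removing the floors changes each of the \<open>M\<close> summands by at most 1; what
  remains is \<open>M\<close> times a harmonic number, which lies between \<open>ln M\<close> and
  \<open>1 + ln M\<close>.\<close>

lemma divisor_sum_bounds:
  assumes "M > 0"
  shows "divisor_sum M \<le> real M * (1 + ln (real M))"
    and "divisor_sum M \<ge> real M * ln (real M) - real M"
proof -
  have harm: "(\<Sum>e=1..M. real M / real e) = real M * harm M"
    by (simp add: harm_def sum_distrib_left divide_inverse)
  have "harm M - ln (real M) \<le> harm 1 - ln (real 1)"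
    using decseqD[OF decseq_harm_diff_ln, of 0 "M - 1"] assms by (simp add: harm_def)
  then have "harm M \<le> 1 + ln (real M)" by (simp add: harm_def)
  then have "real M * harm M \<le> real M * (1 + ln (real M))" by (intro mult_left_mono) auto
  moreover have "divisor_sum M \<le> (\<Sum>e=1..M. real M / real e)"
    unfolding divisor_sum_def by (intro sum_mono of_nat_div_le_of_nat)
  ultimately show "divisor_sum M \<le> real M * (1 + ln (real M))" using harm by simp
  have "ln (real M) \<le> ln (real M + 1)" using assms by simp
  also have "\<dots> \<le> harm M" by (rule ln_le_harm)
  finally have "real M * ln (real M) \<le> real M * harm M" by (intro mult_left_mono) auto
  moreover have "(\<Sum>e=1..M. real M / real e - 1) \<le> divisor_sum M"
    unfolding divisor_sum_def
    by (intro sum_mono divide_minus_one_le_of_nat_div)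
  ultimately show "divisor_sum M \<ge> real M * ln (real M) - real M"
    using harm by (simp add: sum_subtractf)
qed

lemma divisor_sum_nonneg: "divisor_sum M \<ge> 0"
  by (simp add: divisor_sum_def sum_nonneg)

text \<open>Uniform in \<open>m\<close>, including \<open>m > N\<close> where the left side is 0;
  this supplies the majorant for dominated convergence.\<close>

lemma divisor_sum_div_le:
  assumes "m > 0" "N > 0"
  shows "divisor_sum (N div m) \<le> real N / real m * (1 + ln (real N))"
proof (cases "N div m = 0")
  case True
  then show ?thesis using assms by (simp add: divisor_sum_def)
next
  case False
  have "divisor_sum (N div m) \<le> real (N div m) * (1 + ln (real (N div m)))"
    using divisor_sum_bounds(1)[of "N div m"] False by simp
  also have "\<dots> \<le> real N / real m * (1 + ln (real N))"
  proof (intro mult_mono of_nat_div_le_of_nat add_left_mono)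
    have "0 < N div m" "N div m \<le> N" using False by simp_all
    then have "1 \<le> real (N div m)" "real (N div m) \<le> real N" by linarith+
    then show "ln (real (N div m)) \<le> ln (real N)" "0 \<le> 1 + ln (real (N div m))"
      by (auto intro!: ln_mono)
  qed simp
  finally show ?thesis .
qed

lemma divisor_sum_div_tendsto:
  assumes "m > 0"
  shows "(\<lambda>N. divisor_sum (N div m) / (real N * ln (real N))) \<longlonglongrightarrow> 1 / real m"
proof (rule tendsto_sandwich)
  define c where "c = real m"
  have c: "c > 0" using assms by (simp add: c_def)
  let ?l = "\<lambda>N. ((real N / c - 1) * (ln (real N / c - 1) - 1)) / (real N * ln (real N))"
  let ?u = "\<lambda>N. (real N / c * (1 + ln (real N))) / (real N * ln (real N))"
  show "?l \<longlonglongrightarrow> 1 / real m"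
    using c unfolding c_def[symmetric] by (real_asymp simp: field_simps)
  show "?u \<longlonglongrightarrow> 1 / real m"
    using c unfolding c_def[symmetric] by (real_asymp simp: field_simps)
  show "\<forall>\<^sub>F N in sequentially. divisor_sum (N div m) / (real N * ln (real N)) \<le> ?u N"
    using eventually_gt_at_top[of 1]
  proof eventually_elim
    case (elim N)
    then show ?case
      using divisor_sum_div_le[OF assms, of N] unfolding c_def by (intro divide_right_mono) auto
  qed
  have "filterlim (\<lambda>N. real N / c - 1) at_top sequentially" using c by real_asymp
  \<comment> \<open>Above \<open>exp 1\<close> both factors of \<open>t * (ln t - 1)\<close> are
    nonnegative and increasing, so \<open>t\<close> may be replaced by the larger
    \<open>M\<close>.\<close>
  then have "\<forall>\<^sub>F N in sequentially. real N / c - 1 \<ge> exp 1" by (simp add: filterlim_at_top)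
  then show "\<forall>\<^sub>F N in sequentially. ?l N \<le> divisor_sum (N div m) / (real N * ln (real N))"
    using eventually_gt_at_top[of 1]
  proof eventually_elim
    case (elim N)
    define t where "t = real N / c - 1"
    define M where "M = N div m"
    have t: "t \<ge> exp 1" using elim by (simp add: t_def)
    have t0: "t > 0" using t exp_gt_zero[of "1::real"] by linarith
    have M: "real M \<ge> t" using divide_minus_one_le_of_nat_div[of N m] by (simp add: M_def t_def c_def)
    then have M0: "M > 0" using t0 by linarith
    have "t * (ln t - 1) \<le> real M * (ln (real M) - 1)"
    proof (intro mult_mono)
      show "ln t - 1 \<le> ln (real M) - 1" using M t0 by simp
      have "1 \<le> ln t" using t t0 by (simp add: ln_ge_iff)
      then show "0 \<le> ln t - 1" by simp
    qed (use M in auto)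
    also have "\<dots> \<le> divisor_sum M" using divisor_sum_bounds(2)[OF M0] by (simp add: algebra_simps)
    finally show ?case using elim unfolding t_def M_def by (intro divide_right_mono) auto
  qed
qed

text \<open>For \<open>k > 0\<close> this is a difference of two values, the earlier one bounded
  through monotonicity of \<open>c\<close>. The summand 1 covers \<open>k = 0\<close>, where
  \<open>delta f\<close> is 1.\<close>

lemma abs_delta_prime_power_le:
  assumes "prime p" "\<And>k. \<bar>f (p ^ k)\<bar> \<le> c k" "mono c"
  shows "\<bar>delta f (p ^ k)\<bar> \<le> 2 * c k + 1"
proof (cases k)
  case 0
  have "c 0 \<ge> 0" using assms(2)[of 0] by linarith
  with 0 show ?thesis by (simp add: delta_def)
next
  case (Suc j)
  have "c j \<le> c k" using assms(3) Suc by (auto simp: mono_def)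
  moreover have "\<bar>delta f (p ^ k)\<bar> \<le> \<bar>f (p ^ k)\<bar> + \<bar>f (p ^ j)\<bar>"
    using delta_prime_power[OF assms(1), of k f] Suc by (simp add: abs_triangle_ineq4)
  ultimately show ?thesis using assms(2)[of k] assms(2)[of j] by linarith
qed

text \<open>The base 2 stands for the smallest prime. Ratios of consecutive terms tend to 1/2, hence
  are eventually below 3/4.\<close>

lemma summable_poly_geometric: "summable (\<lambda>k. (real k + 1) ^ K / 2 ^ k)"
proof -
  have "(\<lambda>k. ((real k + 2) / (real k + 1)) ^ K) \<longlonglongrightarrow> 1 ^ K"
    by (intro tendsto_power) real_asymp
  then have "\<forall>\<^sub>F k in sequentially. ((real k + 2) / (real k + 1)) ^ K < 3 / 2"
    by (rule order_tendstoD) simp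
  then obtain N where N: "\<And>k. k \<ge> N \<Longrightarrow> ((real k + 2) / (real k + 1)) ^ K < 3 / 2"
    by (auto simp: eventually_sequentially)
  show ?thesis
  proof (rule summable_ratio_test[of "3/4" N])
    fix k assume "N \<le> k"
    then have "((real k + 2) / (real k + 1)) ^ K * ((real k + 1) ^ K / 2 ^ Suc k)
        \<le> 3 / 2 * ((real k + 1) ^ K / 2 ^ Suc k)"
      using N[of k] by (intro mult_right_mono) auto
    then show "norm ((real (Suc k) + 1) ^ K / 2 ^ Suc k) \<le> 3 / 4 * norm ((real k + 1) ^ K / 2 ^ k)"
      by (simp add: power_divide add.commute)
  qed simp
qed

text \<open>Since the values at primes vanish, the Euler factor at \<open>p\<close> is \<open>1 + O(p\<^sup>-\<^sup>2)\<close>.\<close>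

lemma summable_multiplicative_squarefull:
  fixes h :: "nat \<Rightarrow> real"
  assumes h: "multiplicative h" "\<And>p. prime p \<Longrightarrow> h p = 0"
    and c: "\<And>p k. prime p \<Longrightarrow> \<bar>h (p ^ k)\<bar> \<le> c k" "summable (\<lambda>k. c k / 2 ^ k)"
  shows "summable (\<lambda>m. \<bar>h m\<bar> / real m)"
proof -
  define w where "w m = \<bar>h m\<bar> / real m" for m
  have c0: "c k \<ge> 0" for k using c(1)[of 2 k] by (simp add: order_trans[OF abs_ge_zero])
  have w: "multiplicative w" "\<And>n. w n \<ge> 0"
    using h(1) by (auto simp: multiplicative_def w_def abs_mult)
  \<comment> \<open>The factor 4 comes from \<open>p^k >= 2^(k-2) * p^2\<close> for
    \<open>k >= 2\<close>: the term at \<open>p^k\<close> is at most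
    \<open>4 * c k / 2^k / p^2\<close>.\<close>
  define B where "B = 4 * suminf (\<lambda>k. c k / 2 ^ k)"
  have B0: "B \<ge> 0" using c0 c(2) by (simp add: B_def suminf_nonneg)
  have euler: "(\<Sum>k\<le>L. w (p ^ k)) \<le> exp (B / real p ^ 2)" if p: "prime p" for p L
  proof -
    have p2: "real p \<ge> 2" using prime_ge_2_nat[OF p] by simp
    have wk: "w (p ^ k) \<le> (if k = 0 then 1 else 0) + 4 * (c k / 2 ^ k) / real p ^ 2" for k
    proof -
      consider "k = 0" | "k = 1" | j where "k = j + 2"
        by (metis One_nat_def add_2_eq_Suc' not0_implies_Suc)
      then show ?thesis
      proof cases
        case 1 then show ?thesis using w(1) c0 by (simp add: multiplicative_def)
      next
        case 2 then show ?thesis using h(2)[OF p] c0 by (simp add: w_def)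
      next
        case 3
        have "real p ^ k \<ge> 2 ^ j * real p ^ 2"
          using p2 3 by (simp add: power_add power2_eq_square power_mono mult_right_mono)
        then have "\<bar>h (p ^ k)\<bar> / real p ^ k \<le> c k / (2 ^ j * real p ^ 2)"
          using p2 c0 c(1)[OF p] by (intro frac_le) auto
        also have "\<dots> = 4 * (c k / 2 ^ k) / real p ^ 2" using 3 by (simp add: power_add)
        finally show ?thesis using 3 by (simp add: w_def)
      qed
    qed
    have "(\<Sum>k\<le>L. w (p ^ k)) \<le> (\<Sum>k\<le>L. (if k = 0 then 1 else 0) + 4 * (c k / 2 ^ k) / real p ^ 2)"
      by (intro sum_mono wk)
    also have "\<dots> = 1 + 4 * (\<Sum>k\<le>L. c k / 2 ^ k) / real p ^ 2"
      by (simp add: sum.distrib sum_distrib_left sum_divide_distrib)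
    also have "\<dots> \<le> 1 + B / real p ^ 2"
      unfolding B_def using c0 c(2)
      by (intro add_left_mono divide_right_mono mult_left_mono sum_le_suminf) auto
    also have "\<dots> \<le> exp (B / real p ^ 2)" by (rule exp_ge_add_one_self)
    finally show ?thesis .
  qed
  have sq: "summable (\<lambda>n. B / real n ^ 2)"
    using inverse_power_summable[of 2, where ?'a = real]
    by (simp add: divide_inverse summable_mult)
  show ?thesis unfolding w_def[symmetric]
  proof (rule summableI_nonneg_bounded)
    fix n :: nat
    let ?P = "{p. prime p \<and> p < n}"
    have fin: "finite ?P" by simp
    have "(\<Sum>m<n. w m) = (\<Sum>m=1..<n. w m)"
      by (intro sum.mono_neutral_right) (auto simp: w_def)
    also have "\<dots> \<le> (\<Prod>p\<in>?P. exp (B / real p ^ 2))"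
    proof (rule sum_prime_factors_le_prod[OF w euler fin])
      fix m assume "m \<in> {1..<n}"
      then show "m > 0 \<and> prime_factors m \<subseteq> ?P"
        by (auto simp: in_prime_factors_iff dest!: dvd_imp_le)
    qed auto
    also have "\<dots> = exp (\<Sum>p\<in>?P. B / real p ^ 2)" using fin by (simp add: exp_sum)
    also have "\<dots> \<le> exp (suminf (\<lambda>p. B / real p ^ 2))"
      using sq B0 fin by (simp add: sum_le_suminf)
    finally show "(\<Sum>m<n. w m) \<le> exp (suminf (\<lambda>p. B / real p ^ 2))" .
  qed (use w in auto)
qed

text \<open>With \<open>a = 1 * 1 * h\<close> the normalized sum is a series of \<open>h m\<close>
  times normalized divisor sums, each of which tends to \<open>1 / m\<close>. The assumption
  \<open>ge\<close> forces \<open>C >= 1\<close>, so that one may divide by \<open>C\<close> and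
  pass from a limit to an asymptotic equivalence.\<close>

lemma multiplicative_summatory_asymp:
  fixes a :: "nat \<Rightarrow> real" and K :: nat
  assumes a: "multiplicative a" "\<And>p. prime p \<Longrightarrow> a p = 2"
    "\<And>p k. prime p \<Longrightarrow> \<bar>a (p ^ k)\<bar> \<le> (real k + 1) ^ K"
    and ge: "\<And>n. n > 0 \<Longrightarrow> a n \<ge> real (card {d. d dvd n})"
  shows "\<exists>C. (\<lambda>x :: real. \<Sum>n = 1..nat \<lfloor>x\<rfloor>. a n) \<sim>[at_top] (\<lambda>x. C * x * ln x)"
proof -
  define h where "h = delta (delta a)"
  define s where "s m N = h m * (divisor_sum (N div m) / (real N * ln (real N)))" for m N
  have a1: "a 1 = 1" using a(1) by (simp add: multiplicative_def)
  \<comment> \<open>Here \<open>h p = (a p - a 1) - 1\<close>, as \<open>delta a 1 = 1\<close>; the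
    value 2 at primes is exactly what makes it vanish.\<close>
  have h0: "h p = 0" if "prime p" for p
    using delta_prime_power[OF that, of 1 "delta a"] delta_prime_power[OF that, of 1 a] a(2)[OF that] a1
    by (simp add: h_def delta_def)
  have hb: "\<bar>h (p ^ k)\<bar> \<le> 2 * (2 * (real k + 1) ^ K + 1) + 1" if "prime p" for p k
    unfolding h_def using that a(3)
    by (intro abs_delta_prime_power_le) (auto intro!: monoI power_mono)
  have "summable (\<lambda>k. (2 * (2 * (real k + 1) ^ K + 1) + 1) / 2 ^ k)"
  proof -
    have "summable (\<lambda>k. 4 * ((real k + 1) ^ K / 2 ^ k) + 3 * (1 / 2) ^ k)"
      by (intro summable_add summable_mult summable_poly_geometric) simp
    also have "(\<lambda>k. 4 * ((real k + 1) ^ K / 2 ^ k) + 3 * (1 / 2) ^ k) =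
        (\<lambda>k. (2 * (2 * (real k + 1) ^ K + 1) + 1) / 2 ^ k)"
      by (simp add: fun_eq_iff field_simps)
    finally show ?thesis .
  qed
  from summable_multiplicative_squarefull[OF _ h0 hb this]
  have summ: "summable (\<lambda>m. \<bar>h m\<bar> / real m)" by (simp add: h_def multiplicative_delta)
  define C where "C = suminf (\<lambda>m. h m / real m)"
  \<comment> \<open>The series terminates: \<open>N div m\<close> is 0 for \<open>m > N\<close>, and
    also for \<open>m = 0\<close> by division by zero.\<close>
  have s_suminf: "suminf (\<lambda>m. s m N) = (\<Sum>n=1..N. a n) / (real N * ln (real N))" for N
  proof -
    have "suminf (\<lambda>m. s m N) = (\<Sum>m\<in>{1..N}. s m N)"
      by (rule suminf_finite) (auto simp: s_def divisor_sum_def not_le)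
    also have "\<dots> = (\<Sum>m=1..N. h m * divisor_sum (N div m)) / (real N * ln (real N))"
      by (simp add: s_def sum_divide_distrib)
    finally show ?thesis unfolding h_def sum_upto_multiplicative[OF a(1)] .
  qed
  have "(\<lambda>N. suminf (\<lambda>m. s m N)) \<longlonglongrightarrow> C"
    unfolding C_def
  proof (rule tannerys_theorem[THEN conjunct2, THEN conjunct2])
    show "(s m \<longlongrightarrow> h m / real m) sequentially" for m
    proof (cases "m = 0")
      case False
      then show ?thesis using tendsto_mult_left[OF divisor_sum_div_tendsto[of m], of "h m"]
        by (simp add: s_def[abs_def])
    qed (simp add: s_def[abs_def] divisor_sum_def)
    show "summable (\<lambda>m. 2 * (\<bar>h m\<bar> / real m))" using summ by (rule summable_mult)
    have "\<forall>\<^sub>F N in sequentially. \<forall>m. norm (s m N) \<le> 2 * (\<bar>h m\<bar> / real m)"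
      \<comment> \<open>From \<open>N = 3\<close> on \<open>ln N >= 1\<close>, so
        \<open>1 + ln N <= 2 * ln N\<close>; this is the factor 2 of the majorant.\<close>
      using eventually_ge_at_top[of 3]
    proof eventually_elim
      case (elim N)
      have lnN: "ln (real N) \<ge> 1"
        using elim exp_le by (subst ln_ge_iff) auto
      show ?case
      proof
        fix m
        show "norm (s m N) \<le> 2 * (\<bar>h m\<bar> / real m)"
        proof (cases "m = 0")
          case False
          have "divisor_sum (N div m) \<le> real N / real m * (1 + ln (real N))"
            using divisor_sum_div_le[of m N] False elim by simp
          also have "\<dots> \<le> real N / real m * (2 * ln (real N))"
            using lnN by (intro mult_left_mono) auto
          finally have "divisor_sum (N div m) / (real N * ln (real N)) \<le> 2 / real m"
            using lnN elim False by (simp add: field_simps)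
          then have "\<bar>h m\<bar> * (divisor_sum (N div m) / (real N * ln (real N))) \<le> \<bar>h m\<bar> * (2 / real m)"
            by (intro mult_left_mono) auto
          also have "\<dots> = 2 * (\<bar>h m\<bar> / real m)" by simp
          also have "\<bar>h m\<bar> * (divisor_sum (N div m) / (real N * ln (real N))) = norm (s m N)"
            using lnN divisor_sum_nonneg by (simp add: s_def abs_mult)
          finally show ?thesis .
        qed (simp add: s_def divisor_sum_def)
      qed
    qed
    then show "\<forall>\<^sub>F (m, N) in at_top \<times>\<^sub>F sequentially. norm (s m N) \<le> 2 * (\<bar>h m\<bar> / real m)"
      by (intro eventually_prod_filter[THEN iffD2] exI[of _ "\<lambda>_. True"] exI conjI) auto
  qed simp
  then have lim: "(\<lambda>N. (\<Sum>n=1..N. a n) / (real N * ln (real N))) \<longlonglongrightarrow> C"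
    by (simp add: s_suminf)
  have "C \<ge> 1"
  proof (rule tendsto_le[OF _ lim])
    show "(\<lambda>N. divisor_sum (N div 1) / (real N * ln (real N))) \<longlonglongrightarrow> 1"
      using divisor_sum_div_tendsto[of 1] by simp
    show "\<forall>\<^sub>F N in sequentially. divisor_sum (N div 1) / (real N * ln (real N))
        \<le> (\<Sum>n=1..N. a n) / (real N * ln (real N))"
      using eventually_gt_at_top[of 1]
    proof eventually_elim
      case (elim N)
      have "divisor_sum N \<le> (\<Sum>n=1..N. a n)"
        unfolding sum_card_divisors[symmetric] using ge by (intro sum_mono) auto
      then show ?case using elim by (simp add: divide_right_mono)
    qed
  qed simp
  \<comment> \<open>Passage from integers to real \<open>x\<close>: taking the floor changes
    \<open>x * ln x\<close> only by a factor tending to 1.\<close>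
  have "filterlim (\<lambda>x::real. nat \<lfloor>x\<rfloor>) at_top at_top" by real_asymp
  from filterlim_compose[OF lim this]
  have "((\<lambda>x::real. (\<Sum>n=1..nat \<lfloor>x\<rfloor>. a n) / (real (nat \<lfloor>x\<rfloor>) * ln (real (nat \<lfloor>x\<rfloor>)))) \<longlongrightarrow> C) at_top" .
  moreover have "((\<lambda>x::real. real (nat \<lfloor>x\<rfloor>) * ln (real (nat \<lfloor>x\<rfloor>)) / (x * ln x)) \<longlongrightarrow> 1) at_top"
    by real_asymp
  ultimately have "((\<lambda>x::real. (\<Sum>n=1..nat \<lfloor>x\<rfloor>. a n) / (real (nat \<lfloor>x\<rfloor>) * ln (real (nat \<lfloor>x\<rfloor>))) *
      (real (nat \<lfloor>x\<rfloor>) * ln (real (nat \<lfloor>x\<rfloor>)) / (x * ln x)) / C) \<longlongrightarrow> C * 1 / C) at_top"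
    using \<open>C \<ge> 1\<close> by (intro tendsto_intros) auto
  moreover have "C * 1 / C = 1" using \<open>C \<ge> 1\<close> by simp
  ultimately have "((\<lambda>x::real. (\<Sum>n=1..nat \<lfloor>x\<rfloor>. a n) / (C * x * ln x)) \<longlongrightarrow> C * 1 / C) at_top"
  proof (elim Lim_transform_eventually)
    show "\<forall>\<^sub>F x in at_top. (\<Sum>n=1..nat \<lfloor>x\<rfloor>. a n) / (real (nat \<lfloor>x\<rfloor>) * ln (real (nat \<lfloor>x\<rfloor>))) *
      (real (nat \<lfloor>x\<rfloor>) * ln (real (nat \<lfloor>x\<rfloor>)) / (x * ln x)) / C = (\<Sum>n=1..nat \<lfloor>x\<rfloor>. a n) / (C * x * ln x)"
      using eventually_ge_at_top[of "2::real"]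
    proof eventually_elim
      case (elim x)
      define t where "t = real (nat \<lfloor>x\<rfloor>)"
      have "t > 1" using elim unfolding t_def by linarith
      then have "t * ln t \<noteq> 0" by simp
      then show ?case unfolding t_def[symmetric] by simp
    qed
  qed
  then have "(\<lambda>x::real. \<Sum>n = 1..nat \<lfloor>x\<rfloor>. a n) \<sim>[at_top] (\<lambda>x. C * x * ln x)"
    using \<open>C \<ge> 1\<close> by (intro asymp_equivI') simp
  then show ?thesis by blast
qed

section \<open>Generators of finite abelian groups\<close>

text \<open>Tuples are functions of which only the first \<open>r\<close> values count, and
  exponents are integers, so that the relations form a lattice. Entries may be trivial or repeated,
  which permits one fixed length \<open>r\<close> for all groups of rank at most
  \<open>r\<close>.\<close>

primrec word :: "('a, 'b) monoid_scheme \<Rightarrow> (nat \<Rightarrow> 'a) \<Rightarrow> (nat \<Rightarrow> int) \<Rightarrow> nat \<Rightarrow> 'a" where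
  "word G x e 0 = \<one>\<^bsub>G\<^esub>"
| "word G x e (Suc r) = word G x e r \<otimes>\<^bsub>G\<^esub> x r [^]\<^bsub>G\<^esub> e r"

definition words :: "('a, 'b) monoid_scheme \<Rightarrow> (nat \<Rightarrow> 'a) \<Rightarrow> nat \<Rightarrow> 'a set" where
  "words G x r = range (\<lambda>e. word G x e r)"

text \<open>In an abelian group this says that \<open>words G x r\<close> is the internal direct
  product of the cyclic groups generated by the \<open>x i\<close>, some of which may be
  trivial.\<close>

definition independent :: "('a, 'b) monoid_scheme \<Rightarrow> (nat \<Rightarrow> 'a) \<Rightarrow> nat \<Rightarrow> bool" where
  "independent G x r \<longleftrightarrow> (\<forall>e. word G x e r = \<one>\<^bsub>G\<^esub> \<longrightarrow> (\<forall>i<r. x i [^]\<^bsub>G\<^esub> e i = \<one>\<^bsub>G\<^esub>))"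

lemma word_cong:
  "(\<And>i. i < r \<Longrightarrow> x i = y i) \<Longrightarrow> (\<And>i. i < r \<Longrightarrow> e i = f i) \<Longrightarrow> word G x e r = word G y f r"
  by (induction r) auto

lemma words_cong: "(\<And>i. i < r \<Longrightarrow> x i = y i) \<Longrightarrow> words G x r = words G y r"
  unfolding words_def by (intro arg_cong[where f = range] ext word_cong) auto

lemma words_0: "words G x 0 = {\<one>\<^bsub>G\<^esub>}"
  by (simp add: words_def)

lemma words_Suc: "words G x (Suc r) = {a \<otimes>\<^bsub>G\<^esub> x r [^]\<^bsub>G\<^esub> k | a k. a \<in> words G x r \<and> (k::int) \<in> UNIV}"
proof (intro equalityI subsetI)
  fix g assume "g \<in> {a \<otimes>\<^bsub>G\<^esub> x r [^]\<^bsub>G\<^esub> k | a k. a \<in> words G x r \<and> (k::int) \<in> UNIV}"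
  then obtain e k where "g = word G x e r \<otimes>\<^bsub>G\<^esub> x r [^]\<^bsub>G\<^esub> (k::int)" by (auto simp: words_def)
  also have "\<dots> = word G x (e(r := k)) (Suc r)" using word_cong[of r x x e "e(r := k)" G] by simp
  finally show "g \<in> words G x (Suc r)" unfolding words_def by blast
next
  fix g assume "g \<in> words G x (Suc r)"
  then obtain e where "g = word G x e (Suc r)" by (auto simp: words_def)
  then show "g \<in> {a \<otimes>\<^bsub>G\<^esub> x r [^]\<^bsub>G\<^esub> k | a k. a \<in> words G x r \<and> (k::int) \<in> UNIV}"
    unfolding words_def by auto
qed

lemma word_in_words: "word G x e r \<in> words G x r"
  by (simp add: words_def)

context comm_group
begin

lemma word_closed: "x \<in> {..<r} \<rightarrow> carrier G \<Longrightarrow> word G x e r \<in> carrier G"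
  by (induction r) (auto simp: Pi_iff)

lemma word_add:
  "x \<in> {..<r} \<rightarrow> carrier G \<Longrightarrow> word G x (\<lambda>i. e i + f i) r = word G x e r \<otimes> word G x f r"
proof (induction r)
  case (Suc r)
  then have x: "x \<in> {..<r} \<rightarrow> carrier G" "x r \<in> carrier G" by (auto simp: Pi_iff)
  then show ?case using Suc.IH word_closed[OF x(1)] by (simp add: int_pow_mult m_ac)
qed simp

lemma word_zero: "word G x (\<lambda>i. 0) r = \<one>"
  by (induction r) auto

lemma word_minus:
  assumes "x \<in> {..<r} \<rightarrow> carrier G"
  shows "word G x (\<lambda>i. - e i) r = inv (word G x e r)"
proof -
  have "word G x (\<lambda>i. - e i) r \<otimes> word G x e r = \<one>"
    using word_add[OF assms, of "\<lambda>i. - e i" e] by (simp add: word_zero)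
  then show ?thesis using word_closed[OF assms] by (metis inv_equality)
qed

lemma words_closed: "x \<in> {..<r} \<rightarrow> carrier G \<Longrightarrow> words G x r \<subseteq> carrier G"
  by (auto simp: words_def word_closed)

lemma subgroup_words:
  assumes "x \<in> {..<r} \<rightarrow> carrier G"
  shows "subgroup (words G x r) G"
proof (rule subgroupI)
  show "words G x r \<subseteq> carrier G" by (rule words_closed[OF assms])
  show "words G x r \<noteq> {}" by (simp add: words_def)
  show "inv a \<in> words G x r" if "a \<in> words G x r" for a
    using that by (auto simp: words_def word_minus[OF assms, symmetric])
  show "a \<otimes> b \<in> words G x r" if "a \<in> words G x r" "b \<in> words G x r" for a b
    using that by (auto simp: words_def word_add[OF assms, symmetric])
qed

lemma word_in_subgroup:
  assumes "subgroup K G" "\<And>i. i < r \<Longrightarrow> x i \<in> K"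
  shows "word G x e r \<in> K"
  using assms(2)
proof (induction r)
  case (Suc r)
  then show ?case using assms(1) by (simp add: subgroup.m_closed subgroup_int_pow_closed)
qed (simp add: subgroup.one_closed[OF assms(1)])

lemma words_least: "subgroup K G \<Longrightarrow> (\<And>i. i < r \<Longrightarrow> x i \<in> K) \<Longrightarrow> words G x r \<subseteq> K"
  using word_in_subgroup by (auto simp: words_def)

lemma generator_in_words:
  assumes "x \<in> {..<r} \<rightarrow> carrier G" "i < r"
  shows "x i \<in> words G x r"
  using assms
proof (induction r)
  case (Suc r)
  then have x: "x \<in> {..<r} \<rightarrow> carrier G" "x r \<in> carrier G" by (auto simp: Pi_iff)
  show ?case
  proof (cases "i = r")
    case True
    have "\<one> \<otimes> x r [^] (1::int) \<in> words G x (Suc r)"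
      unfolding words_Suc using subgroup.one_closed[OF subgroup_words[OF x(1)]] by blast
    then show ?thesis using True x by simp
  next
    case False
    then have "x i \<in> words G x r" using Suc x by simp
    then have "x i \<otimes> x r [^] (0::int) \<in> words G x (Suc r)"
      unfolding words_Suc by blast
    then show ?thesis using Suc.prems by (auto simp: Pi_iff)
  qed
qed simp

lemma words_eqI:
  assumes "x \<in> {..<r} \<rightarrow> carrier G" "y \<in> {..<s} \<rightarrow> carrier G"
    "\<And>i. i < r \<Longrightarrow> x i \<in> words G y s" "\<And>i. i < s \<Longrightarrow> y i \<in> words G x r"
  shows "words G x r = words G y s"
  by (intro equalityI words_least subgroup_words assms)

text \<open>A Bezout step: the exponents are merged into a power of a single generator by
  unimodular changes of two generators at a time.\<close>

lemma word_eq_power_of_generator: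
  assumes "x \<in> {..<Suc r} \<rightarrow> carrier G"
  shows "\<exists>x' d. x' \<in> {..<Suc r} \<rightarrow> carrier G \<and> words G x' (Suc r) = words G x (Suc r) \<and>
    word G x e (Suc r) = x' r [^] (d::int) \<and> (\<forall>i\<le>r. d dvd e i)"
  using assms
proof (induction r)
  case 0
  then have "x 0 \<in> carrier G" by auto
  with 0 show ?case by (intro exI[of _ x] exI[of _ "e 0"]) auto
next
  case (Suc r)
  have x: "x \<in> {..<Suc r} \<rightarrow> carrier G" "x (Suc r) \<in> carrier G" using Suc.prems by (auto simp: Pi_iff)
  from Suc.IH[OF x(1)] obtain x' d0 where x': "x' \<in> {..<Suc r} \<rightarrow> carrier G"
    "words G x' (Suc r) = words G x (Suc r)" "word G x e (Suc r) = x' r [^] (d0::int)" "\<forall>i\<le>r. d0 dvd e i"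
    by blast
  define z w c where "z = x' r" and "w = x (Suc r)" and "c = e (Suc r)"
  have zw: "z \<in> carrier G" "w \<in> carrier G" using x x' by (auto simp: z_def w_def Pi_iff)
  define d where "d = gcd d0 c"
  obtain p q u v where pq: "d0 = d * p" "c = d * q" "u * p + v * q = 1"
  proof (cases "d = 0")
    case True
    then show ?thesis using that[of 1 0 1 0] by (simp add: d_def)
  next
    case False
    obtain u v where "u * d0 + v * c = d" using bezout_int[of d0 c] d_def by metis
    moreover obtain p q where "d0 = d * p" "c = d * q" unfolding d_def
      by (meson dvdE gcd_dvd1 gcd_dvd2)
    ultimately have "d * (u * p + v * q) = d * 1" by (simp add: algebra_simps)
    then have "u * p + v * q = 1" using False by (metis mult_left_cancel)
    then show ?thesis using that \<open>d0 = d * p\<close> \<open>c = d * q\<close> by blast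
  qed
  \<comment> \<open>The substitution has matrix \<open>(p, q; -v, u)\<close> of determinant
    \<open>u * p + v * q = 1\<close>. It is invertible over the integers, so the generated subgroup
    stays the same, while the product of \<open>z^d0\<close> and \<open>w^c\<close> becomes
    \<open>y^d\<close>.\<close>
  define y z' where "y = z [^] p \<otimes> w [^] q" and "z' = z [^] (- v) \<otimes> w [^] u"
  have yz': "y \<in> carrier G" "z' \<in> carrier G" using zw by (auto simp: y_def z'_def)
  have comb: "(z [^] a \<otimes> w [^] b) [^] i \<otimes> (z [^] a' \<otimes> w [^] b') [^] j
      = z [^] (a * i + a' * j) \<otimes> w [^] (b * i + b' * j)" for a b a' b' i j :: int
    using zw by (simp add: int_pow_distrib int_pow_pow int_pow_mult m_ac)
  have z_eq: "z = y [^] u \<otimes> z' [^] (- q)" and w_eq: "w = y [^] v \<otimes> z' [^] p"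
    using pq(3) zw unfolding y_def z'_def comb by (simp_all add: algebra_simps)
  \<comment> \<open>The merged generator \<open>y\<close> goes to the last place, where the claim
    and the next induction step expect it.\<close>
  define x'' where "x'' = x'(r := z', Suc r := y)"
  have x''c: "x'' \<in> {..<Suc (Suc r)} \<rightarrow> carrier G"
    using x'(1) yz' by (auto simp: x''_def Pi_iff less_Suc_eq)
  note sub'' = subgroup_words[OF x''c]
  note sub = subgroup_words[OF Suc.prems]
  have words_le: "words G x (Suc r) \<subseteq> words G x (Suc (Suc r))"
    using generator_in_words[OF Suc.prems] by (intro words_least[OF sub]) auto
  have "words G x'' (Suc (Suc r)) = words G x (Suc (Suc r))"
  proof (rule words_eqI[OF x''c Suc.prems])
    have x'_in: "x' i \<in> words G x (Suc (Suc r))" if "i < Suc r" for i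
      using generator_in_words[OF x'(1) that] x'(2) words_le by auto
    have zw_in: "z \<in> words G x (Suc (Suc r))" "w \<in> words G x (Suc (Suc r))"
      using x'_in generator_in_words[OF Suc.prems, of "Suc r"] by (auto simp: z_def w_def)
    show "x'' i \<in> words G x (Suc (Suc r))" if "i < Suc (Suc r)" for i
      using x'_in[of i] zw_in that sub
      by (auto simp: x''_def y_def z'_def subgroup.m_closed subgroup_int_pow_closed)
    have yz'_in: "y \<in> words G x'' (Suc (Suc r))" "z' \<in> words G x'' (Suc (Suc r))"
      using generator_in_words[OF x''c, of "Suc r"] generator_in_words[OF x''c, of r] by (auto simp: x''_def)
    have zw_in'': "z \<in> words G x'' (Suc (Suc r))" "w \<in> words G x'' (Suc (Suc r))"
      by (subst z_eq w_eq, intro subgroup.m_closed[OF sub''] subgroup_int_pow_closed[OF sub''] yz'_in)+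
    have "x' i \<in> words G x'' (Suc (Suc r))" if "i < Suc r" for i
      using zw_in'' that generator_in_words[OF x''c, of i] by (cases "i = r") (auto simp: x''_def z_def)
    then have "words G x (Suc r) \<subseteq> words G x'' (Suc (Suc r))"
      unfolding x'(2)[symmetric] by (intro words_least[OF sub'']) auto
    then show "x i \<in> words G x'' (Suc (Suc r))" if "i < Suc (Suc r)" for i
      using zw_in'' that generator_in_words[OF x(1), of i] by (cases "i = Suc r") (auto simp: w_def)
  qed
  moreover have "word G x e (Suc (Suc r)) = x'' (Suc r) [^] d"
  proof -
    have "word G x e (Suc (Suc r)) = z [^] d0 \<otimes> w [^] c" using x'(3) by (simp add: z_def w_def c_def)
    also have "\<dots> = y [^] d"
      using zw unfolding pq(1,2) y_def by (simp add: int_pow_distrib int_pow_pow mult.commute[of d])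
    finally show ?thesis by (simp add: x''_def)
  qed
  moreover have "\<forall>i\<le>Suc r. d dvd e i"
    using x'(4) by (auto simp: d_def c_def le_Suc_eq intro: dvd_trans)
  ultimately show ?case using x''c by blast
qed

lemma independent_Suc:
  assumes x: "x \<in> {..<Suc r} \<rightarrow> carrier G" "independent G x r"
    and last: "\<And>a k. a \<in> words G x r \<Longrightarrow> a \<otimes> x r [^] (k::int) = \<one> \<Longrightarrow> x r [^] k = \<one>"
  shows "independent G x (Suc r)"
  unfolding independent_def
proof (intro allI impI)
  fix e i assume e: "word G x e (Suc r) = \<one>" and i: "i < Suc r"
  have r: "x r [^] e r = \<one>" using last[OF word_in_words, of e "e r"] e by simp
  have "x \<in> {..<r} \<rightarrow> carrier G" using x(1) by auto
  then have "word G x e r = \<one>" using e r word_closed by simp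
  then show "x i [^] e i = \<one>" using r x(2) i by (auto simp: independent_def less_Suc_eq)
qed

text \<open>The order of the last generator is made minimal among all generating tuples; a relation in
  which its exponent is not a multiple of its order would give a generator of smaller order.\<close>

lemma ex_independent_words:
  assumes "finite (carrier G)" "x \<in> {..<r} \<rightarrow> carrier G"
  shows "\<exists>y. y \<in> {..<r} \<rightarrow> carrier G \<and> words G y r = words G x r \<and> independent G y r"
  using assms(2)
proof (induction r arbitrary: x)
  case 0
  then show ?case by (intro exI[of _ x]) (auto simp: independent_def)
next
  case (Suc r)
  define Q where "Q z \<longleftrightarrow> z \<in> {..<Suc r} \<rightarrow> carrier G \<and> words G z (Suc r) = words G x (Suc r)" for z
  obtain z where z: "Q z" and z_min: "\<And>z'. Q z' \<Longrightarrow> ord (z r) \<le> ord (z' r)"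
    using ex_has_least_nat[of Q x "\<lambda>z. ord (z r)"] Suc.prems by (auto simp: Q_def)
  have zc: "z \<in> {..<Suc r} \<rightarrow> carrier G" "z r \<in> carrier G" using z by (auto simp: Q_def Pi_iff)
  have last: "z r [^] e r = \<one>" if rel: "word G z e (Suc r) = \<one>" for e
  proof (rule ccontr)
    assume ne: "z r [^] e r \<noteq> \<one>"
    have ord_pos: "ord (z r) > 0" using ord_ge_1[OF assms(1) zc(2)] by simp
    \<comment> \<open>Reducing the exponent modulo the order keeps the relation and gives
      \<open>0 < m < ord (z r)\<close>. The Bezout step then yields a tuple whose last entry is
      killed by a divisor \<open>d\<close> of \<open>m\<close>, so its order is at most
      \<open>m\<close>, against minimality.\<close>
    define m where "m = e r mod int (ord (z r))"
    have m: "0 < m" "m < int (ord (z r))"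
    proof -
      have "\<not> int (ord (z r)) dvd e r" using ne int_pow_eq_id[OF zc(2)] by simp
      then have "m \<noteq> 0" by (simp add: m_def dvd_eq_mod_eq_0)
      moreover have "m \<ge> 0" using ord_pos by (simp add: m_def)
      ultimately show "0 < m" by simp
      show "m < int (ord (z r))" using ord_pos by (simp add: m_def)
    qed
    have "z r [^] m = z r [^] e r"
      using zc(2) by (simp add: int_pow_eq m_def dvd_minus_mod)
    then have "word G z (e(r := m)) (Suc r) = \<one>"
      using rel word_cong[of r z z e "e(r := m)" G] by simp
    moreover obtain z' d where z': "z' \<in> {..<Suc r} \<rightarrow> carrier G" "words G z' (Suc r) = words G z (Suc r)"
      "word G z (e(r := m)) (Suc r) = z' r [^] (d::int)" "\<forall>i\<le>r. d dvd (e(r := m)) i"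
      using word_eq_power_of_generator[OF zc(1), of "e(r := m)"] by blast
    ultimately have "z' r [^] d = \<one>" by simp
    moreover have z'c: "z' r \<in> carrier G" using z'(1) by auto
    ultimately have "int (ord (z' r)) dvd d" using int_pow_eq_id by blast
    moreover have "d dvd m" using z'(4) by (metis fun_upd_same order_refl)
    ultimately have "int (ord (z' r)) \<le> m" using m(1) by (meson dvd_trans zdvd_imp_le)
    moreover have "Q z'" using z z' by (simp add: Q_def)
    ultimately show False using z_min m(2) by fastforce
  qed
  have zr: "z \<in> {..<r} \<rightarrow> carrier G" using zc by auto
  \<comment> \<open>The first \<open>r\<close> generators are replaced by independent ones with the
    same span. The property \<open>last\<close> depends on them only through this span, so it
    survives.\<close>
  obtain y where y: "y \<in> {..<r} \<rightarrow> carrier G" "words G y r = words G z r" "independent G y r"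
    using Suc.IH[OF zr] by blast
  define y' where "y' = y(r := z r)"
  have y': "words G y' r = words G z r" "independent G y' r" "y' r = z r"
    using y(2,3) words_cong[of r y y' G] word_cong[of r y y' _ _ G] by (auto simp: y'_def independent_def)
  have y'c: "y' \<in> {..<Suc r} \<rightarrow> carrier G" using y zc by (auto simp: y'_def Pi_iff less_Suc_eq)
  have "independent G y' (Suc r)"
  proof (rule independent_Suc[OF y'c y'(2)])
    fix a k assume "a \<in> words G y' r" and *: "a \<otimes> y' r [^] (k::int) = \<one>"
    then obtain e where e: "a = word G z e r" using y'(1) by (auto simp: words_def)
    then have "word G z (e(r := k)) (Suc r) = \<one>"
      using * y'(3) word_cong[of r z z e "e(r := k)" G] by simp
    from last[OF this] show "y' r [^] k = \<one>" using y'(3) by simp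
  qed
  moreover have "words G y' (Suc r) = words G x (Suc r)"
    using z y'(1,3) by (simp add: Q_def words_Suc)
  ultimately show ?case using y'c by blast
qed

text \<open>The orders alone thus fix the lattice of relations, which is why they determine the
  group.\<close>

lemma independent_word_eq_one_iff:
  assumes "x \<in> {..<r} \<rightarrow> carrier G" "independent G x r"
  shows "word G x e r = \<one> \<longleftrightarrow> (\<forall>i<r. int (ord (x i)) dvd e i)"
proof
  assume "word G x e r = \<one>"
  then show "\<forall>i<r. int (ord (x i)) dvd e i"
    using assms int_pow_eq_id by (auto simp: independent_def Pi_iff)
next
  assume "\<forall>i<r. int (ord (x i)) dvd e i"
  moreover have "x i [^] e i = \<one>" if "i < r" "int (ord (x i)) dvd e i" for i
    using that assms(1) int_pow_eq_id by (auto simp: Pi_iff)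
  ultimately have "\<forall>i<r. x i [^] e i = \<one>" by blast
  then show "word G x e r = \<one>" by (induction r) auto
qed

lemma word_eq_iff:
  assumes "x \<in> {..<r} \<rightarrow> carrier G"
  shows "word G x e r = word G x f r \<longleftrightarrow> word G x (\<lambda>i. e i - f i) r = \<one>"
proof -
  have "word G x (\<lambda>i. e i - f i) r = word G x e r \<otimes> inv (word G x f r)"
    using word_add[OF assms, of e "\<lambda>i. - f i"] word_minus[OF assms, of f] by simp
  then show ?thesis using word_closed[OF assms] inv_solve_right'[of "\<one>" "word G x e r" "word G x f r"]
    by auto
qed

text \<open>The exponents of the last generator that occur in \<open>K\<close> form an ideal of the
  integers, generated by some \<open>d\<close>. An element \<open>g\<close> of \<open>K\<close> with
  last exponent \<open>d\<close> reduces every element of \<open>K\<close> to the intersection with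
  the span of the first \<open>r\<close> generators, where induction applies. This is why rank does
  not grow in subgroups.\<close>

lemma subgroup_of_words:
  assumes "x \<in> {..<r} \<rightarrow> carrier G" "subgroup K G" "K \<subseteq> words G x r"
  shows "\<exists>y. y \<in> {..<r} \<rightarrow> carrier G \<and> words G y r = K"
  using assms
proof (induction r arbitrary: K)
  case 0
  then have "K = {\<one>}" using subgroup.one_closed by (auto simp: words_0)
  then show ?case by (auto simp: words_0)
next
  case (Suc r)
  have x: "x \<in> {..<r} \<rightarrow> carrier G" "x r \<in> carrier G" using Suc.prems by (auto simp: Pi_iff)
  note S = subgroup_words[OF x(1)]
  have KG: "K \<subseteq> carrier G" using Suc.prems(2) by (rule subgroup.subset)
  obtain y where y: "y \<in> {..<r} \<rightarrow> carrier G" "words G y r = K \<inter> words G x r"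
    using Suc.IH[OF x(1) subgroups_Inter_pair[OF Suc.prems(2) S]] by blast
  define I where "I = {k::int. \<exists>a\<in>words G x r. a \<otimes> x r [^] k \<in> K}"
  have step: "i - q * j \<in> I" if ij: "i \<in> I" "j \<in> I" for i j q
  proof -
    obtain a b where ab: "a \<in> words G x r" "b \<in> words G x r" "a \<otimes> x r [^] i \<in> K" "b \<otimes> x r [^] j \<in> K"
      using ij unfolding I_def by blast
    then have c: "a \<in> carrier G" "b \<in> carrier G" using words_closed[OF x(1)] by auto
    have "(a \<otimes> x r [^] i) \<otimes> (b \<otimes> x r [^] j) [^] (- q) \<in> K"
      using ab Suc.prems(2) by (simp add: subgroup.m_closed subgroup_int_pow_closed)
    also have "(a \<otimes> x r [^] i) \<otimes> (b \<otimes> x r [^] j) [^] (- q) = (a \<otimes> b [^] (- q)) \<otimes> x r [^] (i - q * j)"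
    proof -
      have "x r [^] (i - q * j) = x r [^] i \<otimes> x r [^] (j * (- q))"
        using x(2) by (simp add: int_pow_mult[symmetric] mult.commute)
      then show ?thesis using c x(2) by (simp add: int_pow_distrib int_pow_pow m_ac)
    qed
    finally show ?thesis
      using ab S unfolding I_def by (blast intro: subgroup.m_closed subgroup_int_pow_closed)
  qed
  have I0: "0 \<in> I" unfolding I_def
    using subgroup.one_closed[OF S] subgroup.one_closed[OF Suc.prems(2)] x(2) by force
  \<comment> \<open>The least positive member of \<open>I\<close> if there is one, by division with
    remainder, and otherwise 0; in the latter case \<open>g\<close> already lies in the span of the
    first \<open>r\<close> generators.\<close>
  obtain d where d: "d \<in> I" "\<And>i. i \<in> I \<Longrightarrow> d dvd i"
  proof (cases "\<exists>i\<in>I. i \<noteq> 0")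
    case False
    then show ?thesis using that[of 0] I0 by auto
  next
    case True
    then obtain i where i: "i \<in> I" "i \<noteq> 0" by blast
    then have "- i \<in> I" using step[OF I0 i(1), of 1] by simp
    then have "\<exists>n. n > 0 \<and> int n \<in> I"
      using i by (intro exI[of _ "nat \<bar>i\<bar>"]) (auto simp: abs_if)
    then obtain n where n: "n > 0" "int n \<in> I" "\<And>m. m > 0 \<Longrightarrow> int m \<in> I \<Longrightarrow> n \<le> m"
      using exists_least_iff[of "\<lambda>n. n > 0 \<and> int n \<in> I"] by (metis not_less)
    show ?thesis
    proof (rule that[OF n(2)])
      fix j assume "j \<in> I"
      then have "j - (j div int n) * int n \<in> I" using step n(2) by blast
      then have *: "j mod int n \<in> I" by (simp add: minus_div_mult_eq_mod)
      have "j mod int n = 0"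
      proof (rule ccontr)
        assume "j mod int n \<noteq> 0"
        moreover have "j mod int n \<ge> 0" "j mod int n < int n" using n(1) by auto
        ultimately show False using n(3)[of "nat (j mod int n)"] * by simp
      qed
      then show "int n dvd j" by presburger
    qed
  qed
  obtain a0 where a0: "a0 \<in> words G x r" "a0 \<otimes> x r [^] d \<in> K" using d(1) by (auto simp: I_def)
  have a0c: "a0 \<in> carrier G" using a0 words_closed[OF x(1)] by auto
  define g where "g = a0 \<otimes> x r [^] d"
  have g: "g \<in> K" "g \<in> carrier G" using a0 KG by (auto simp: g_def)
  define y' where "y' = y(r := g)"
  have y'c: "y' \<in> {..<Suc r} \<rightarrow> carrier G" using y g by (auto simp: y'_def Pi_iff less_Suc_eq)
  have y': "words G y' r = K \<inter> words G x r" using y words_cong[of r y y' G] by (simp add: y'_def)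
  have "words G y' (Suc r) = K"
  proof
    show "words G y' (Suc r) \<subseteq> K"
      using y' g Suc.prems(2) by (auto simp: words_Suc y'_def intro!: subgroup.m_closed subgroup_int_pow_closed)
    show "K \<subseteq> words G y' (Suc r)"
    proof
      fix k assume k: "k \<in> K"
      then have "k \<in> words G x (Suc r)" using Suc.prems(3) by blast
      then obtain a and i :: int where a: "k = a \<otimes> x r [^] i" "a \<in> words G x r"
        unfolding words_Suc by blast
      then have "i \<in> I" using k by (auto simp: I_def)
      then obtain q where q: "i = d * q" using d(2) by blast
      have ac: "a \<in> carrier G" using a words_closed[OF x(1)] by auto
      \<comment> \<open>The element \<open>k\<close> with its last exponent cleared by a power of
        \<open>g\<close>; it lies in \<open>K\<close> as well as in the span of the first
        \<open>r\<close> generators.\<close>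
      define b where "b = a \<otimes> inv (a0 [^] q)"
      have "b \<in> words G x r" unfolding b_def using a a0 S
        by (simp add: subgroup.m_closed subgroup.m_inv_closed subgroup_int_pow_closed)
      have gq: "g [^] q = a0 [^] q \<otimes> x r [^] i"
        using a0c x(2) by (simp add: g_def q int_pow_distrib int_pow_pow)
      have k_eq: "k = b \<otimes> g [^] q"
        using ac a0c x(2) unfolding gq a(1) b_def by (simp add: m_assoc) (simp add: m_assoc[symmetric])
      have "b = k \<otimes> inv (g [^] q)"
        using k_eq ac a0c g(2) by (simp add: b_def m_assoc)
      then have "b \<in> K"
        using k g(1) Suc.prems(2) by (simp add: subgroup.m_closed subgroup.m_inv_closed subgroup_int_pow_closed)
      then show "k \<in> words G y' (Suc r)"
        using k_eq \<open>b \<in> words G x r\<close> y' by (auto simp: words_Suc y'_def)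
    qed
  qed
  then show ?case using y'c by blast
qed

end

text \<open>Equal orders give equal relation lattices, so sending a word of \<open>G\<close> to the
  word of \<open>H\<close> with the same exponents is well defined and injective.\<close>

lemma independent_words_iso:
  assumes "comm_group G" "comm_group H"
    and x: "x \<in> {..<r} \<rightarrow> carrier G" "independent G x r" "words G x r = carrier G"
    and y: "y \<in> {..<r} \<rightarrow> carrier H" "independent H y r" "words H y r = carrier H"
    and ord: "\<And>i. i < r \<Longrightarrow> group.ord G (x i) = group.ord H (y i)"
  shows "G \<cong> H"
proof -
  interpret G: comm_group G by fact
  interpret H: comm_group H by fact
  have eq: "word G x e r = word G x f r \<longleftrightarrow> word H y e r = word H y f r" for e f
    unfolding G.word_eq_iff[OF x(1)] H.word_eq_iff[OF y(1)]
      G.independent_word_eq_one_iff[OF x(1,2)] H.independent_word_eq_one_iff[OF y(1,2)]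
    using ord by auto
  define h where "h g = word H y (SOME e. word G x e r = g) r" for g
  have h: "h (word G x e r) = word H y e r" for e
    unfolding h_def by (rule someI2[of _ e]) (use eq in auto)
  have "h \<in> iso G H"
  proof (rule isoI)
    show "h \<in> hom G H"
    proof (rule homI)
      fix a b assume "a \<in> carrier G" "b \<in> carrier G"
      then have "a \<in> range (\<lambda>e. word G x e r)" "b \<in> range (\<lambda>e. word G x e r)"
        using x(3) by (simp_all add: words_def)
      then obtain e f where ef: "a = word G x e r" "b = word G x f r" by blast
      show "h a \<in> carrier H" using y(1) by (simp add: ef h H.word_closed)
      show "h (a \<otimes>\<^bsub>G\<^esub> b) = h a \<otimes>\<^bsub>H\<^esub> h b"
        unfolding ef h using x(1) y(1) by (simp add: G.word_add[symmetric] H.word_add[symmetric] h)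
    qed
    have "inj_on h (carrier G)"
      unfolding x(3)[symmetric] words_def by (auto simp: inj_on_def h eq)
    moreover have "h ` carrier G = carrier H"
      unfolding x(3)[symmetric] y(3)[symmetric] words_def by (auto simp: h image_image)
    ultimately show "bij_betw h (carrier G) (carrier H)" by (simp add: bij_betw_def)
  qed
  then show ?thesis by (auto simp: is_iso_def)
qed

section \<open>Isomorphism classes of bounded rank\<close>

definition rank_group :: "nat \<Rightarrow> nat \<Rightarrow> ('a, 'b) monoid_scheme \<Rightarrow> bool" where
  "rank_group r n G \<longleftrightarrow> comm_group G \<and> finite (carrier G) \<and> order G = n \<and> group_rank G \<le> r"

text \<open>The argument may have any carrier type while the members live on \<open>nat\<close>. So
  direct products and the integers modulo \<open>n\<close> have classes that can be compared with
  those in the definitions.\<close>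

definition iso_class :: "('a, 'b) monoid_scheme \<Rightarrow> nat monoid set" where
  "iso_class G = {H. group H \<and> G \<cong> H}"

lemma iso_class_eqI:
  assumes "group G" "group H" "G \<cong> H"
  shows "iso_class G = iso_class H"
proof (intro equalityI subsetI)
  fix K assume K: "K \<in> iso_class G"
  have "H \<cong> G" using group.iso_sym[OF assms(1,3)] .
  then have "H \<cong> K" using K iso_trans by (auto simp: iso_class_def)
  then show "K \<in> iso_class H" using K by (simp add: iso_class_def)
next
  fix K assume K: "K \<in> iso_class H"
  then have "G \<cong> K" using iso_trans[OF assms(3)] by (auto simp: iso_class_def)
  then show "K \<in> iso_class G" using K by (simp add: iso_class_def)
qed

lemma ex_nat_copy:
  assumes "group G" "finite (carrier G)"
  shows "\<exists>H :: nat monoid. group H \<and> G \<cong> H"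
proof -
  interpret group G by fact
  obtain f :: "'a \<Rightarrow> nat" where f: "inj_on f (carrier G)"
    using finite_imp_inj_to_nat_seg[OF assms(2)] by blast
  let ?H = "image_group f G"
  have "f \<in> iso G ?H"
    using f by (auto simp: iso_def hom_def bij_betw_def image_group_def)
  moreover from this have "group (?H\<lparr>one := f \<one>\<^bsub>G\<^esub>\<rparr>)" by (rule iso_imp_img_group)
  ultimately show ?thesis by (intro exI[of _ ?H]) (auto simp: is_iso_def image_group_def)
qed

text \<open>Finiteness provides a copy of \<open>G\<close> on \<open>nat\<close>, so the class is
  not empty, and a common member links \<open>G\<close> to \<open>H\<close>.\<close>

lemma iso_class_eq_iff:
  assumes "group G" "group H" "finite (carrier G)"
  shows "iso_class G = iso_class H \<longleftrightarrow> G \<cong> H"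
proof
  assume eq: "iso_class G = iso_class H"
  obtain K :: "nat monoid" where K: "group K" "G \<cong> K" using ex_nat_copy[OF assms(1,3)] by blast
  then have "K \<in> iso_class H" unfolding eq[symmetric] by (simp add: iso_class_def)
  then have "H \<cong> K" by (simp add: iso_class_def)
  then have "K \<cong> H" by (rule group.iso_sym[OF assms(2)])
  with K(2) show "G \<cong> H" by (rule iso_trans)
qed (rule iso_class_eqI[OF assms(1,2)])

section \<open>Homomorphisms, subgroups and rank\<close>

lemma word_hom:
  assumes "h \<in> hom G H" "comm_group G" "group H" "x \<in> {..<r} \<rightarrow> carrier G"
  shows "h (word G x e r) = word H (\<lambda>i. h (x i)) e r"
  using assms(4)
proof (induction r)
  case 0
  then show ?case using assms(1-3) by (simp add: hom_one comm_group_def)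
next
  case (Suc r)
  interpret G: comm_group G by fact
  have x: "x \<in> {..<r} \<rightarrow> carrier G" "x r \<in> carrier G" using Suc.prems by (auto simp: Pi_iff)
  show ?case using Suc.IH[OF x(1)] x assms(1,3) G.word_closed[OF x(1)]
    by (simp add: hom_mult hom_int_pow)
qed

lemma words_hom:
  assumes "h \<in> hom G H" "comm_group G" "group H" "x \<in> {..<r} \<rightarrow> carrier G"
  shows "words H (\<lambda>i. h (x i)) r = h ` words G x r"
  using word_hom[OF assms] by (simp add: words_def image_image)

lemma (in comm_group) subgroup_comm_group: "subgroup K G \<Longrightarrow> comm_group (G\<lparr>carrier := K\<rparr>)"
  by (intro group.group_comm_groupI subgroup_imp_group) (auto simp: m_comm subgroup.mem_carrier)

lemma (in comm_group) words_subgroup: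
  assumes "subgroup K G" "x \<in> {..<r} \<rightarrow> K"
  shows "words (G\<lparr>carrier := K\<rparr>) x r = words G x r"
proof -
  have "id \<in> hom (G\<lparr>carrier := K\<rparr>) G"
    using assms(1) by (auto simp: hom_def subgroup.mem_carrier)
  from words_hom[OF this subgroup_comm_group[OF assms(1)] is_group, of x r] assms(2)
  show ?thesis by simp
qed

text \<open>A generating set of at most \<open>r\<close> elements is listed and padded with the unit
  to length exactly \<open>r\<close>; conversely, the entries of a tuple form a generating
  set.\<close>

lemma group_rank_le_iff:
  assumes "comm_group G" "finite (carrier G)"
  shows "group_rank G \<le> r \<longleftrightarrow> (\<exists>x. x \<in> {..<r} \<rightarrow> carrier G \<and> words G x r = carrier G)"
proof
  interpret comm_group G by fact
  define Q where "Q k \<longleftrightarrow> (\<exists>S. S \<subseteq> carrier G \<and> finite S \<and> card S = k \<and> generate G S = carrier G)" for k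
  have rank: "group_rank G = (LEAST k. Q k)" by (simp add: group_rank_def Q_def)
  {
    assume le: "group_rank G \<le> r"
    have "generate G (carrier G) = carrier G"
      using generate_subgroup_incl[OF order_refl subgroup_self] by (auto intro: generate.incl)
    then have "Q (card (carrier G))" using assms(2) by (auto simp: Q_def)
    then have "Q (group_rank G)" unfolding rank by (rule LeastI)
    then obtain S where S: "S \<subseteq> carrier G" "finite S" "card S \<le> r" "generate G S = carrier G"
      using le by (auto simp: Q_def)
    obtain f where f: "bij_betw f {..<card S} S"
      using S(2) ex_bij_betw_nat_finite[of S] by (auto simp: atLeast0LessThan)
    define x where "x i = (if i < card S then f i else \<one>\<^bsub>G\<^esub>)" for i
    have x: "x \<in> {..<r} \<rightarrow> carrier G"
      using bij_betwE[OF f] S(1) by (auto simp: x_def subset_iff)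
    have "S \<subseteq> words G x r"
    proof
      fix s assume "s \<in> S"
      then obtain i where "i < card S" "s = f i" using f by (auto simp: bij_betw_def)
      then show "s \<in> words G x r" using generator_in_words[OF x, of i] S(3) by (simp add: x_def)
    qed
    then have "carrier G \<subseteq> words G x r"
      unfolding S(4)[symmetric] by (rule generate_subgroup_incl[OF _ subgroup_words[OF x]])
    then show "\<exists>x. x \<in> {..<r} \<rightarrow> carrier G \<and> words G x r = carrier G"
      using x words_closed[OF x] by blast
  next
    assume "\<exists>x. x \<in> {..<r} \<rightarrow> carrier G \<and> words G x r = carrier G"
    then obtain x where x: "x \<in> {..<r} \<rightarrow> carrier G" "words G x r = carrier G" by blast
    have S: "x ` {..<r} \<subseteq> carrier G" using x(1) by auto
    have "words G x r \<subseteq> generate G (x ` {..<r})"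
      by (rule words_least[OF generate_is_subgroup[OF S]]) (auto intro: generate.incl)
    then have "generate G (x ` {..<r}) = carrier G"
      using x(2) generate_incl[OF S] by blast
    then have "Q (card (x ` {..<r}))" using S by (auto simp: Q_def)
    then have "group_rank G \<le> card (x ` {..<r})" unfolding rank by (rule Least_le)
    also have "\<dots> \<le> r" using card_image_le[of "{..<r}" x] by simp
    finally show "group_rank G \<le> r" .
  }
qed

lemma rank_group_iff:
  "rank_group r n G \<longleftrightarrow> comm_group G \<and> finite (carrier G) \<and> order G = n \<and>
    (\<exists>x. x \<in> {..<r} \<rightarrow> carrier G \<and> words G x r = carrier G)"
  using group_rank_le_iff by (auto simp: rank_group_def)

text \<open>The \<open>r\<close> generators of \<open>K\<close> come from
  \<open>subgroup_of_words\<close>; the divisibility is Lagrange's theorem.\<close>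

lemma rank_group_subgroup:
  assumes "rank_group r n G" "subgroup K G"
  shows "rank_group r (card K) (G\<lparr>carrier := K\<rparr>)" "card K dvd n"
proof -
  interpret comm_group G using assms(1) by (simp add: rank_group_def)
  obtain x where x: "x \<in> {..<r} \<rightarrow> carrier G" "words G x r = carrier G"
    using assms(1) unfolding rank_group_iff by blast
  have K: "K \<subseteq> carrier G" using assms(2) by (rule subgroup.subset)
  obtain y where y: "y \<in> {..<r} \<rightarrow> carrier G" "words G y r = K"
    using subgroup_of_words[OF x(1) assms(2)] K x(2) by auto
  have yK: "y \<in> {..<r} \<rightarrow> K" using generator_in_words[OF y(1)] y(2) by auto
  then have "words (G\<lparr>carrier := K\<rparr>) y r = K" using words_subgroup[OF assms(2) yK] y(2) by simp
  then show "rank_group r (card K) (G\<lparr>carrier := K\<rparr>)"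
    using subgroup_comm_group[OF assms(2)] yK K assms(1) finite_subset
    unfolding rank_group_iff by (auto simp: Coset.order_def)
  show "card K dvd n"
    using lagrange[OF assms(2)] assms(1) by (metis dvd_triv_right rank_group_def)
qed

lemma rank_group_iso:
  assumes "rank_group r n G" "group H" "G \<cong> H"
  shows "rank_group r n H"
proof -
  interpret comm_group G using assms(1) by (simp add: rank_group_def)
  have H: "comm_group H" using iso_imp_comm_group[OF assms(3)] assms(2) by (simp add: group_def)
  obtain h where h: "h \<in> iso G H" using assms(3) by (auto simp: is_iso_def)
  obtain x where x: "x \<in> {..<r} \<rightarrow> carrier G" "words G x r = carrier G"
    using assms(1) unfolding rank_group_iff by blast
  have hc: "h \<in> hom G H" "h ` carrier G = carrier H" using h by (auto simp: iso_def bij_betw_def)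
  have "words H (\<lambda>i. h (x i)) r = carrier H"
    using words_hom[OF hc(1) comm_group_axioms assms(2) x(1)] x(2) hc(2) by simp
  moreover have "(\<lambda>i. h (x i)) \<in> {..<r} \<rightarrow> carrier H" using x(1) hc(2) by auto
  ultimately show ?thesis
    using H assms(1) iso_same_card[OF assms(3)] iso_finite[OF assms(3)]
    unfolding rank_group_iff Coset.order_def by auto
qed

definition classes_dividing :: "nat \<Rightarrow> nat \<Rightarrow> nat monoid set set" where
  "classes_dividing r n = {iso_class G |G :: nat monoid. \<exists>d. d dvd n \<and> rank_group r d G}"

text \<open>A group of rank at most \<open>r\<close> is determined up to isomorphism by the orders of
  \<open>r\<close> independent generators, which divide the order of the group.\<close>

lemma classes_dividing_bound:
  assumes "n > 0"
  shows "finite (classes_dividing r n)" "card (classes_dividing r n) \<le> card {d. d dvd n} ^ r"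
proof -
  define T where "T = {..<r} \<rightarrow>\<^sub>E {d. d dvd n}"
  define R where "R G x \<longleftrightarrow> comm_group G \<and> x \<in> {..<r} \<rightarrow> carrier G \<and> independent G x r \<and>
    words G x r = carrier G" for G :: "nat monoid" and x
  \<comment> \<open>A tuple of orders goes to the class of some group realizing it, and to an
    arbitrary value if there is none. As the orders fix the group, every class is reached.\<close>
  define F where "F t = iso_class (SOME G. \<exists>x. R G x \<and> (\<forall>i<r. group.ord G (x i) = t i))" for t
  have fin: "finite T" using assms by (auto simp: T_def intro!: finite_PiE)
  have sub: "classes_dividing r n \<subseteq> F ` T"
  proof
    fix c assume "c \<in> classes_dividing r n"
    then obtain G :: "nat monoid" and d where G: "c = iso_class G" "d dvd n" "rank_group r d G"
      by (auto simp: classes_dividing_def)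
    interpret comm_group G using G(3) by (simp add: rank_group_def)
    have finG: "finite (carrier G)" "order G = d" using G(3) by (auto simp: rank_group_def)
    obtain x0 where "x0 \<in> {..<r} \<rightarrow> carrier G" "words G x0 r = carrier G"
      using G(3) unfolding rank_group_iff by blast
    then obtain x where x: "R G x"
      using ex_independent_words[OF finG(1), of x0 r] comm_group_axioms unfolding R_def by metis
    define t where "t = restrict (\<lambda>i. ord (x i)) {..<r}"
    have "t \<in> T"
      using x G(2) ord_dvd_group_order finG(2) by (auto simp: T_def t_def R_def intro: dvd_trans)
    moreover have "\<exists>x. R G x \<and> (\<forall>i<r. ord (x i) = t i)" using x by (auto simp: t_def)
    then have "\<exists>y. R (SOME G. \<exists>x. R G x \<and> (\<forall>i<r. group.ord G (x i) = t i)) y \<and>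
        (\<forall>i<r. group.ord (SOME G. \<exists>x. R G x \<and> (\<forall>i<r. group.ord G (x i) = t i)) (y i) = t i)"
      by (rule someI)
    then obtain H y where H: "F t = iso_class H" "R H y" "\<And>i. i < r \<Longrightarrow> group.ord H (y i) = t i"
      unfolding F_def by blast
    have "G \<cong> H"
      using x H(2,3) unfolding R_def
      by (intro independent_words_iso[of G H x r y]) (auto simp: t_def)
    then have "c = F t"
      using iso_class_eqI[of G H] H(2) is_group unfolding H(1) G(1) R_def comm_group_def by blast
    ultimately show "c \<in> F ` T" by blast
  qed
  then show "finite (classes_dividing r n)" using fin finite_subset by blast
  have "card (classes_dividing r n) \<le> card T" using sub fin by (rule surj_card_le[rotated])
  then show "card (classes_dividing r n) \<le> card {d. d dvd n} ^ r" by (simp add: T_def card_PiE)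
qed

text \<open>Only the isomorphism type of the subgroup is recorded, not its position in
  \<open>G\<close>, so isomorphic subgroups of \<open>G\<close> are counted once.\<close>

definition class_pairs :: "nat \<Rightarrow> nat \<Rightarrow> (nat monoid set \<times> nat monoid set) set" where
  "class_pairs r n =
    {(iso_class G, iso_class (G\<lparr>carrier := K\<rparr>)) |(G :: nat monoid) K. rank_group r n G \<and> subgroup K G}"

lemma class_pairs_subset: "class_pairs r n \<subseteq> classes_dividing r n \<times> classes_dividing r n"
proof
  fix z assume "z \<in> class_pairs r n"
  then obtain G :: "nat monoid" and K where GK: "z = (iso_class G, iso_class (G\<lparr>carrier := K\<rparr>))"
    "rank_group r n G" "subgroup K G" unfolding class_pairs_def by blast
  show "z \<in> classes_dividing r n \<times> classes_dividing r n"
    unfolding GK(1) classes_dividing_def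
    using GK(2) rank_group_subgroup[OF GK(2,3)] dvd_refl by blast
qed

lemma class_pairs_bound:
  assumes "n > 0"
  shows "finite (class_pairs r n)" "card (class_pairs r n) \<le> card {d. d dvd n} ^ (2 * r)"
proof -
  note * = classes_dividing_bound[OF assms, of r]
  show "finite (class_pairs r n)"
    using class_pairs_subset[of r n] * by (meson finite_SigmaI finite_subset)
  have "card (class_pairs r n) \<le> card (classes_dividing r n) * card (classes_dividing r n)"
    using card_mono[OF _ class_pairs_subset[of r n]] * by (simp add: card_cartesian_product)
  also have "\<dots> \<le> card {d. d dvd n} ^ r * card {d. d dvd n} ^ r" using * by (intro mult_mono) auto
  finally show "card (class_pairs r n) \<le> card {d. d dvd n} ^ (2 * r)"
    by (simp add: power_add[symmetric] mult_2)
qed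

text \<open>Carries membership over to groups of any carrier type, such as direct products and the
  integers modulo \<open>n\<close>.\<close>

lemma class_pairs_memI:
  assumes "rank_group r n G" "subgroup K G"
  shows "(iso_class G, iso_class (G\<lparr>carrier := K\<rparr>)) \<in> class_pairs r n"
proof -
  have G: "group G" "finite (carrier G)" using assms(1) by (auto simp: rank_group_def comm_group_def)
  obtain H :: "nat monoid" where H: "group H" "G \<cong> H" using ex_nat_copy[OF G] by blast
  obtain h where h: "h \<in> iso G H" using H(2) by (auto simp: is_iso_def)
  note * = iso_subgroup_image[OF G(1) H(1) h assms(2)]
  have "iso_class G = iso_class H" by (rule iso_class_eqI[OF G(1) H])
  moreover have "iso_class (G\<lparr>carrier := K\<rparr>) = iso_class (H\<lparr>carrier := h ` K\<rparr>)"
    using * group.subgroup_imp_group[OF G(1) assms(2)] group.subgroup_imp_group[OF H(1) *(1)]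
    by (intro iso_class_eqI)
  moreover have "rank_group r n H" by (rule rank_group_iso[OF assms(1) H])
  ultimately show ?thesis using *(1) unfolding class_pairs_def by blast
qed

text \<open>The pairs are fibred over the classes of \<open>G\<close>. Isomorphic groups have the
  same classes of subgroups, so each fibre can be computed from the chosen representative.\<close>

lemma subgroup_class_total_eq_card:
  assumes "n > 0"
  shows "subgroup_class_total r n = card (class_pairs r n)"
proof -
  define S where "S G = {iso_class (G\<lparr>carrier := K\<rparr>) |K. subgroup K G}" for G :: "nat monoid"
  have Image: "group_iso_rel `` {G} = iso_class G" if "group G" for G
    using that by (auto simp: group_iso_rel_def iso_class_def)
  have num: "num_subgroup_classes G = card (S G)" if G: "group G" for G
  proof -
    have "{H. group H \<and> (\<exists>K. subgroup K G \<and> H \<cong> G\<lparr>carrier := K\<rparr>)} // group_iso_rel = S G"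
    proof (intro equalityI subsetI)
      fix c assume "c \<in> {H. group H \<and> (\<exists>K. subgroup K G \<and> H \<cong> G\<lparr>carrier := K\<rparr>)} // group_iso_rel"
      then obtain H K where H: "group H" "subgroup K G" "H \<cong> G\<lparr>carrier := K\<rparr>" "c = group_iso_rel `` {H}"
        unfolding quotient_def by blast
      have "c = iso_class (G\<lparr>carrier := K\<rparr>)"
        using iso_class_eqI[OF H(1) group.subgroup_imp_group[OF G H(2)] H(3)] Image[OF H(1)] H(4) by simp
      then show "c \<in> S G" using H(2) by (auto simp: S_def)
    next
      fix c assume "c \<in> S G"
      then obtain K where K: "subgroup K G" "c = iso_class (G\<lparr>carrier := K\<rparr>)" by (auto simp: S_def)
      have gK: "group (G\<lparr>carrier := K\<rparr>)" using group.subgroup_imp_group[OF G K(1)] .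
      have "c = group_iso_rel `` {G\<lparr>carrier := K\<rparr>}" using Image[OF gK] K(2) by simp
      moreover have "G\<lparr>carrier := K\<rparr> \<in> {H. group H \<and> (\<exists>K. subgroup K G \<and> H \<cong> G\<lparr>carrier := K\<rparr>)}"
        using gK K(1) iso_refl by blast
      ultimately show "c \<in> {H. group H \<and> (\<exists>K. subgroup K G \<and> H \<cong> G\<lparr>carrier := K\<rparr>)} // group_iso_rel"
        by (simp only: quotientI)
    qed
    then show ?thesis by (simp add: num_subgroup_classes_def)
  qed
  have classes: "abelian_classes r n = {iso_class G |G :: nat monoid. rank_group r n G}"
  proof -
    have "abelian_classes r n = {group_iso_rel `` {G} |G. rank_group r n G}"
      by (auto simp: abelian_classes_def rank_group_def quotient_def)
    also have "\<dots> = {iso_class G |G :: nat monoid. rank_group r n G}"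
      using Image by (metis (no_types, lifting) comm_group_def rank_group_def)
    finally show ?thesis .
  qed
  have rep: "rank_group r n (SOME G. G \<in> c) \<and> iso_class (SOME G. G \<in> c) = c"
    if c: "c \<in> abelian_classes r n" for c
  proof -
    obtain G :: "nat monoid" where G: "c = iso_class G" "rank_group r n G" using c classes by auto
    then have gG: "group G" by (simp add: rank_group_def comm_group_def)
    define H where "H = (SOME G. G \<in> c)"
    have "G \<in> c" using G gG by (simp add: iso_class_def)
    then have "H \<in> c" unfolding H_def by (rule someI)
    then have *: "group H" "G \<cong> H" using G(1) by (auto simp: iso_class_def)
    show ?thesis unfolding H_def[symmetric]
      using rank_group_iso[OF G(2) *] iso_class_eqI[OF gG *] G(1) by simp
  qed
  have pairs: "class_pairs r n = Sigma (abelian_classes r n) (\<lambda>c. S (SOME G. G \<in> c))"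
  proof (intro equalityI subsetI)
    fix z assume "z \<in> class_pairs r n"
    then obtain G :: "nat monoid" and K where GK: "z = (iso_class G, iso_class (G\<lparr>carrier := K\<rparr>))"
      "rank_group r n G" "subgroup K G" unfolding class_pairs_def by blast
    define c where "c = iso_class G"
    define H where "H = (SOME G. G \<in> c)"
    have c: "c \<in> abelian_classes r n" using GK(2) by (auto simp: classes c_def)
    have gG: "group G" "finite (carrier G)" using GK(2) by (auto simp: rank_group_def comm_group_def)
    have H: "group H" "iso_class H = c"
      using rep[OF c] unfolding H_def[symmetric] by (auto simp: rank_group_def comm_group_def)
    then have "G \<cong> H" using iso_class_eq_iff[OF gG(1) H(1) gG(2)] by (simp add: c_def)
    then obtain h where h: "h \<in> iso G H" by (auto simp: is_iso_def)
    note * = iso_subgroup_image[OF gG(1) H(1) h GK(3)]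
    have "iso_class (G\<lparr>carrier := K\<rparr>) = iso_class (H\<lparr>carrier := h ` K\<rparr>)"
      using * group.subgroup_imp_group[OF gG(1) GK(3)] group.subgroup_imp_group[OF H(1) *(1)]
      by (intro iso_class_eqI)
    then have "iso_class (G\<lparr>carrier := K\<rparr>) \<in> S H" using *(1) unfolding S_def by blast
    then show "z \<in> Sigma (abelian_classes r n) (\<lambda>c. S (SOME G. G \<in> c))"
      using c unfolding GK(1) c_def[symmetric] H_def by simp
  next
    fix z assume "z \<in> Sigma (abelian_classes r n) (\<lambda>c. S (SOME G. G \<in> c))"
    then obtain c d where z: "z = (c, d)" "c \<in> abelian_classes r n" "d \<in> S (SOME G. G \<in> c)" by auto
    from rep[OF z(2)] z(1,3) show "z \<in> class_pairs r n"
      unfolding class_pairs_def S_def by blast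
  qed
  have fin: "finite (class_pairs r n)" by (rule class_pairs_bound[OF assms])
  have S_ne: "S G \<noteq> {}" if "group G" for G
    using group.subgroup_self[OF that] unfolding S_def by blast
  \<comment> \<open>No fibre is empty, since a group is a subgroup of itself; hence the classes of
    \<open>G\<close> are a projection of the finite set of pairs.\<close>
  have finA: "finite (abelian_classes r n)"
  proof (rule finite_subset)
    show "abelian_classes r n \<subseteq> fst ` class_pairs r n"
    proof
      fix c assume c: "c \<in> abelian_classes r n"
      then obtain d where "d \<in> S (SOME G. G \<in> c)"
        using S_ne rep[OF c] by (fastforce simp: rank_group_def comm_group_def)
      with c have "(c, d) \<in> class_pairs r n" unfolding pairs by simp
      then show "c \<in> fst ` class_pairs r n" by force
    qed
  qed (use fin in simp)
  have finS: "finite (S (SOME G. G \<in> c))" if "c \<in> abelian_classes r n" for c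
    by (rule finite_subset[of _ "snd ` class_pairs r n"]) (use that fin pairs in force)+
  have "subgroup_class_total r n = (\<Sum>c\<in>abelian_classes r n. card (S (SOME G. G \<in> c)))"
    unfolding subgroup_class_total_def
  proof (intro sum.cong refl num)
    show "group (SOME G. G \<in> c)" if "c \<in> abelian_classes r n" for c
      using rep[OF that] by (simp add: rank_group_def comm_group_def)
  qed
  also have "\<dots> = card (class_pairs r n)"
    unfolding pairs using finA finS by (subst card_SigmaI) auto
  finally show ?thesis .
qed

section \<open>Products of groups of coprime orders\<close>

definition torsion :: "('a, 'b) monoid_scheme \<Rightarrow> nat \<Rightarrow> 'a set" where
  "torsion G m = {g \<in> carrier G. g [^]\<^bsub>G\<^esub> m = \<one>\<^bsub>G\<^esub>}"

context comm_group
begin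

lemma subgroup_torsion: "subgroup (torsion G m) G"
  by (rule subgroupI) (auto simp: torsion_def nat_pow_distrib nat_pow_inv)

lemma eq_one_if_coprime_pow:
  assumes "g \<in> carrier G" "g [^] (m::nat) = \<one>" "g [^] (n::nat) = \<one>" "coprime m n"
  shows "g = \<one>"
proof -
  have "ord g dvd m" "ord g dvd n" using assms by (auto simp: pow_eq_id)
  then have "ord g = 1" using assms(4) by (metis coprime_common_divisor_nat)
  then show ?thesis using assms(1) ord_eq_1 by blast
qed

text \<open>With \<open>u * m + v * n = 1\<close>, an element \<open>g\<close> is the product of
  \<open>g^(v * n)\<close>, killed by \<open>m\<close>, and \<open>g^(u * m)\<close>, killed by
  \<open>n\<close>. Uniqueness holds because an element killed by both numbers is trivial.\<close>

lemma torsion_decomposition: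
  assumes "coprime m n" "\<And>g. g \<in> carrier G \<Longrightarrow> g [^] (m * n) = \<one>"
  shows "(\<lambda>(a, b). a \<otimes> b) \<in> iso (G\<lparr>carrier := torsion G m\<rparr> \<times>\<times> G\<lparr>carrier := torsion G n\<rparr>) G"
proof (rule isoI)
  let ?f = "\<lambda>(a, b). a \<otimes> b"
  let ?P = "G\<lparr>carrier := torsion G m\<rparr> \<times>\<times> G\<lparr>carrier := torsion G n\<rparr>"
  have tc: "torsion G k \<subseteq> carrier G" for k by (auto simp: torsion_def)
  show "?f \<in> hom ?P G"
  proof (rule homI)
    show "?f x \<in> carrier G" if "x \<in> carrier ?P" for x using that tc by auto
    fix x y assume "x \<in> carrier ?P" "y \<in> carrier ?P"
    then obtain a b a' b' where "x = (a, b)" "y = (a', b')"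
      "a \<in> carrier G" "b \<in> carrier G" "a' \<in> carrier G" "b' \<in> carrier G"
      using tc by fastforce
    then show "?f (x \<otimes>\<^bsub>?P\<^esub> y) = ?f x \<otimes> ?f y" by (simp add: m_ac)
  qed
  show "bij_betw ?f (carrier ?P) (carrier G)"
  proof (rule bij_betw_imageI)
    show "inj_on ?f (carrier ?P)"
    proof (rule inj_onI, clarsimp)
      fix a b a' b' assume *: "a \<in> torsion G m" "b \<in> torsion G n" "a' \<in> torsion G m" "b' \<in> torsion G n"
        and eq: "a \<otimes> b = a' \<otimes> b'"
      then have c: "a \<in> carrier G" "b \<in> carrier G" "a' \<in> carrier G" "b' \<in> carrier G" using tc by auto
      \<comment> \<open>By \<open>eq\<close> this also equals the product of \<open>b'\<close> with
        the inverse of \<open>b\<close>, so it is killed by \<open>m\<close> and by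
        \<open>n\<close>.\<close>
      define z where "z = inv a' \<otimes> a"
      have zc: "z \<in> carrier G" using c by (simp add: z_def)
      have "z \<otimes> b = b'" using c eq unfolding z_def by (simp add: m_assoc) (simp add: m_assoc[symmetric])
      then have "z = b' \<otimes> inv b" using c zc by (metis inv_solve_right)
      then have "z [^] n = \<one>" using * c by (simp add: torsion_def nat_pow_distrib nat_pow_inv)
      moreover have "z [^] m = \<one>" using * c by (simp add: z_def torsion_def nat_pow_distrib nat_pow_inv)
      ultimately have "z = \<one>" using eq_one_if_coprime_pow[OF zc] assms(1) by blast
      then show "a = a' \<and> b = b'" using c eq unfolding z_def
        by (metis \<open>z \<otimes> b = b'\<close> \<open>z = \<one>\<close> inv_comm inv_equality inv_inv l_one inv_closed)
    qed
    show "?f ` carrier ?P = carrier G"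
    proof (intro equalityI subsetI)
      show "g \<in> carrier G" if "g \<in> ?f ` carrier ?P" for g using that tc by auto
      fix g assume g: "g \<in> carrier G"
      obtain u v where uv: "u * int m + v * int n = 1"
        using bezout_int[of "int m" "int n"] assms(1) by (auto simp: coprime_iff_gcd_eq_1)
      have kill: "(g [^] (w * int l)) [^] k = \<one>" if "l * k = m * n" for w and l k :: nat
      proof -
        have "(g [^] (w * int l)) [^] k = g [^] (int (m * n) * w)"
          using g unfolding that[symmetric]
          by (simp add: int_pow_pow mult_ac flip: int_pow_int)
        also have "\<dots> = (g [^] (m * n)) [^] w"
          using g by (simp only: int_pow_pow[symmetric] int_pow_int)
        finally show ?thesis using assms(2)[OF g] by simp
      qed
      have "g [^] (v * int n) \<in> torsion G m" "g [^] (u * int m) \<in> torsion G n"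
        using g kill[of n m v] kill[of m n u] by (auto simp: torsion_def mult.commute)
      moreover have "g [^] (v * int n) \<otimes> g [^] (u * int m) = g"
        using g uv by (simp add: int_pow_mult[symmetric] add.commute)
      ultimately show "g \<in> ?f ` carrier ?P" by force
    qed
  qed
qed

text \<open>The decomposition yields the product of the two cardinalities. By Cauchy's theorem a
  prime dividing the size of the \<open>k\<close>-torsion is the order of an element killed by
  \<open>k\<close>, so it divides \<open>k\<close>; this assigns each cardinality to its own
  factor.\<close>

lemma card_torsion:
  assumes "finite (carrier G)" "order G = m * n" "coprime m n" "m > 0" "n > 0"
  shows "card (torsion G m) = m" "card (torsion G n) = n"
proof -
  have exp: "g [^] (m * n) = \<one>" if "g \<in> carrier G" for g
    using pow_order_eq_1[OF that] assms(2) by simp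
  have prod: "card (torsion G m) * card (torsion G n) = m * n"
    using bij_betw_same_card[OF torsion_decomposition[OF assms(3) exp, unfolded iso_def, simplified, THEN conjunct2]]
      assms(2) by (simp add: card_cartesian_product Coset.order_def)
  have cop: "coprime (card (torsion G k)) l" if "coprime k l" for k l
  proof (rule ccontr)
    assume ncop: "\<not> coprime (card (torsion G k)) l"
    obtain p where p: "prime p" "p dvd card (torsion G k)" "p dvd l"
    proof -
      have "gcd (card (torsion G k)) l \<noteq> 1" using ncop by (simp add: coprime_iff_gcd_eq_1)
      then obtain p where "prime p" "p dvd gcd (card (torsion G k)) l" using prime_factor_nat by blast
      then show ?thesis using that by simp
    qed
    let ?T = "G\<lparr>carrier := torsion G k\<rparr>"
    have T: "group ?T" "finite (carrier ?T)"
      using subgroup_imp_group[OF subgroup_torsion] assms(1) by (auto simp: torsion_def)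
    obtain q where "card (torsion G k) = p * q" using p(2) by (rule dvdE)
    \<comment> \<open>Sylow's theorem with exponent 1 serves as Cauchy's theorem, whatever the full
      power of \<open>p\<close> in the order.\<close>
    then have "order ?T = p ^ 1 * q" by (simp add: Coset.order_def)
    then obtain H where H: "subgroup H ?T" "card H = p ^ 1"
      using sylow_thm[OF p(1) T(1) _ T(2)] by blast
    have "card H > 1" using H(2) prime_gt_1_nat[OF p(1)] by simp
    then obtain h where h: "h \<in> H" "h \<noteq> \<one>"
    proof -
      have "\<not> H \<subseteq> {\<one>}" using \<open>card H > 1\<close> card_mono[of "{\<one>}" H] by auto
      then show ?thesis using that by blast
    qed
    have hT: "h \<in> torsion G k" using subgroup.subset[OF H(1)] h by auto
    then have hc: "h \<in> carrier G" "h [^] k = \<one>" by (auto simp: torsion_def)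
    have "h [^]\<^bsub>?T\<lparr>carrier := H\<rparr>\<^esub> card H = \<one>"
      using group.pow_order_eq_1[OF group.subgroup_imp_group[OF T(1) H(1)], of h] h(1) by (simp add: Coset.order_def)
    then have "h [^] p = \<one>" using H(2) by (simp flip: nat_pow_consistent)
    moreover have "coprime p k" using that p by (meson coprime_commute coprime_divisors dvd_refl)
    ultimately show False using eq_one_if_coprime_pow[OF hc(1) _ hc(2)] h(2) by blast
  qed
  have "card (torsion G m) dvd m" using prod cop[OF assms(3)] 
    by (metis coprime_dvd_mult_left_iff dvd_triv_left)
  moreover have "card (torsion G n) dvd n" using prod cop[of n m] assms(3)
    by (metis coprime_commute coprime_dvd_mult_right_iff dvd_triv_right)
  ultimately have le: "card (torsion G m) \<le> m" "card (torsion G n) \<le> n"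
    using assms(4,5) by (auto intro: dvd_imp_le)
  show "card (torsion G m) = m"
  proof (rule ccontr)
    assume "card (torsion G m) \<noteq> m"
    then have "card (torsion G m) * card (torsion G n) < m * n"
      using le assms(5) by (intro le_less_trans[OF mult_le_mono2[OF le(2)] mult_strict_right_mono]) auto
    with prod show False by simp
  qed
  with prod show "card (torsion G n) = n" using assms(4) by simp
qed

end

text \<open>The \<open>H2\<close>-component of an image of \<open>G1\<close> is killed by both
  \<open>m\<close> and \<open>n\<close>, hence trivial, so the \<open>H1\<close>-component alone
  still separates the elements of \<open>G1\<close>.\<close>

lemma inj_hom_of_DirProd_iso:
  assumes G: "group G1" "group G2" and H: "group H1" "comm_group H2"
    and f: "f \<in> iso (G1 \<times>\<times> G2) (H1 \<times>\<times> H2)"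
    and m: "\<And>g. g \<in> carrier G1 \<Longrightarrow> g [^]\<^bsub>G1\<^esub> (m::nat) = \<one>\<^bsub>G1\<^esub>"
    and n: "\<And>h. h \<in> carrier H2 \<Longrightarrow> h [^]\<^bsub>H2\<^esub> (n::nat) = \<one>\<^bsub>H2\<^esub>" and mn: "coprime m n"
  shows "(\<lambda>g. fst (f (g, \<one>\<^bsub>G2\<^esub>))) \<in> mon G1 H1"
proof -
  interpret G1: group G1 by fact
  interpret G2: group G2 by fact
  interpret H1: group H1 by fact
  interpret H2: comm_group H2 by fact
  let ?i = "\<lambda>g. (g, \<one>\<^bsub>G2\<^esub>)"
  have fh: "f \<in> hom (G1 \<times>\<times> G2) (H1 \<times>\<times> H2)" and inj: "inj_on f (carrier (G1 \<times>\<times> G2))"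
    using f by (auto simp: iso_def bij_betw_def)
  have i: "?i \<in> hom G1 (G1 \<times>\<times> G2)" by (auto simp: hom_def)
  have comp: "f \<circ> ?i \<in> hom G1 (H1 \<times>\<times> H2)" using hom_compose[OF i fh] .
  then have p: "fst \<circ> (f \<circ> ?i) \<in> hom G1 H1" "snd \<circ> (f \<circ> ?i) \<in> hom G1 H2"
    using hom_pairwise by blast+
  have snd: "snd (f (?i g)) = \<one>\<^bsub>H2\<^esub>" if g: "g \<in> carrier G1" for g
  proof -
    have c: "snd (f (?i g)) \<in> carrier H2" using hom_in_carrier[OF p(2) g] by simp
    have "snd (f (?i g)) [^]\<^bsub>H2\<^esub> m = (snd \<circ> (f \<circ> ?i)) (g [^]\<^bsub>G1\<^esub> m)"
      using hom_nat_pow[OF p(2) g G(1) H2.is_group, of m] by simp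
    also have "\<dots> = \<one>\<^bsub>H2\<^esub>"
      unfolding m[OF g] using hom_one[OF p(2) G(1) H2.is_group] .
    finally show ?thesis using H2.eq_one_if_coprime_pow[OF c _ n[OF c] mn] by blast
  qed
  have "inj_on (\<lambda>g. fst (f (?i g))) (carrier G1)"
  proof (rule inj_onI)
    fix a b assume ab: "a \<in> carrier G1" "b \<in> carrier G1" "fst (f (?i a)) = fst (f (?i b))"
    then have "f (?i a) = f (?i b)" using snd by (simp add: prod_eq_iff)
    then show "a = b" using inj_onD[OF inj, of "?i a" "?i b"] ab by simp
  qed
  then show ?thesis using p(1) by (simp add: mon_def comp_def)
qed

text \<open>The isomorphism and its inverse give injections in both directions between finite
  groups, so the injection \<open>\<phi>\<close> is onto.\<close>

lemma DirProd_cancel: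
  assumes "comm_group G1" "comm_group G2" "comm_group H1" "comm_group H2"
    and "finite (carrier G1)" "finite (carrier H1)"
    and m: "\<And>g. g \<in> carrier G1 \<Longrightarrow> g [^]\<^bsub>G1\<^esub> (m::nat) = \<one>\<^bsub>G1\<^esub>"
      "\<And>g. g \<in> carrier H1 \<Longrightarrow> g [^]\<^bsub>H1\<^esub> (m::nat) = \<one>\<^bsub>H1\<^esub>"
    and n: "\<And>g. g \<in> carrier G2 \<Longrightarrow> g [^]\<^bsub>G2\<^esub> (n::nat) = \<one>\<^bsub>G2\<^esub>"
      "\<And>g. g \<in> carrier H2 \<Longrightarrow> g [^]\<^bsub>H2\<^esub> (n::nat) = \<one>\<^bsub>H2\<^esub>"
    and mn: "coprime m n" and iso: "G1 \<times>\<times> G2 \<cong> H1 \<times>\<times> H2"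
  shows "G1 \<cong> H1"
proof -
  have g: "group G1" "group G2" "group H1" "group H2" using assms(1-4) by (auto simp: comm_group_def)
  obtain f where f: "f \<in> iso (G1 \<times>\<times> G2) (H1 \<times>\<times> H2)" using iso by (auto simp: is_iso_def)
  obtain f' where f': "f' \<in> iso (H1 \<times>\<times> H2) (G1 \<times>\<times> G2)"
    using group.iso_sym[OF DirProd_group[OF g(1,2)] iso] by (auto simp: is_iso_def)
  define \<phi> where "\<phi> = (\<lambda>g. fst (f (g, \<one>\<^bsub>G2\<^esub>)))"
  have \<phi>: "\<phi> \<in> mon G1 H1" unfolding \<phi>_def
    by (rule inj_hom_of_DirProd_iso[OF g(1,2,3) assms(4) f m(1) n(2) mn])
  have "(\<lambda>g. fst (f' (g, \<one>\<^bsub>H2\<^esub>))) \<in> mon H1 G1"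
    by (rule inj_hom_of_DirProd_iso[OF g(3,4,1) assms(2) f' m(2) n(1) mn])
  then have "card (carrier H1) \<le> card (carrier G1)"
    using assms(5) by (intro card_inj_on_le) (auto simp: mon_def hom_def)
  moreover have "\<phi> ` carrier G1 \<subseteq> carrier H1" "inj_on \<phi> (carrier G1)"
    using \<phi> by (auto simp: mon_def hom_def)
  ultimately have "\<phi> ` carrier G1 = carrier H1"
    using assms(6) by (metis card_image card_seteq)
  then have "\<phi> \<in> iso G1 H1" using \<phi> by (simp add: iso_iff mon_def)
  then show ?thesis by (auto simp: is_iso_def)
qed

lemma DirProd_iso_cong: "group G \<Longrightarrow> group H \<Longrightarrow> G \<cong> G' \<Longrightarrow> H \<cong> H' \<Longrightarrow> G \<times>\<times> H \<cong> G' \<times>\<times> H'"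
  unfolding is_iso_def using iso_paired2[of G H _ _ G' H'] by (metis all_not_in_conv)

section \<open>Rank and classes of direct products\<close>

lemma comm_group_DirProd:
  assumes "comm_group G" "comm_group H"
  shows "comm_group (G \<times>\<times> H)"
proof (rule group.group_comm_groupI[OF DirProd_group])
  fix a b assume "a \<in> carrier (G \<times>\<times> H)" "b \<in> carrier (G \<times>\<times> H)"
  then show "a \<otimes>\<^bsub>G \<times>\<times> H\<^esub> b = b \<otimes>\<^bsub>G \<times>\<times> H\<^esub> a"
    using assms by (auto simp: comm_group_def comm_monoid.m_comm)
qed (use assms in \<open>auto simp: comm_group_def\<close>)

lemma word_DirProd:
  assumes "comm_group G" "comm_group H" "x \<in> {..<r} \<rightarrow> carrier G" "y \<in> {..<r} \<rightarrow> carrier H"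
  shows "word (G \<times>\<times> H) (\<lambda>i. (x i, y i)) e r = (word G x e r, word H y e r)"
proof -
  have g: "group G" "group H" using assms(1,2) by (auto simp: comm_group_def)
  have GH: "comm_group (G \<times>\<times> H)" by (rule comm_group_DirProd[OF assms(1,2)])
  have xy: "(\<lambda>i. (x i, y i)) \<in> {..<r} \<rightarrow> carrier (G \<times>\<times> H)" using assms(3,4) by auto
  have "fst \<in> hom (G \<times>\<times> H) G" "snd \<in> hom (G \<times>\<times> H) H" by (auto simp: hom_def)
  from word_hom[OF this(1) GH g(1) xy, of e] word_hom[OF this(2) GH g(2) xy, of e]
  show ?thesis by (simp add: prod_eq_iff)
qed

lemma (in comm_group) word_cong_exponent:
  assumes "x \<in> {..<r} \<rightarrow> carrier G" "\<And>g. g \<in> carrier G \<Longrightarrow> g [^] (m::nat) = \<one>"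
    "\<And>i. i < r \<Longrightarrow> e i mod int m = f i mod int m"
  shows "word G x e r = word G x f r"
  using assms(1,3)
proof (induction r)
  case (Suc r)
  have x: "x \<in> {..<r} \<rightarrow> carrier G" "x r \<in> carrier G" using Suc.prems by (auto simp: Pi_iff)
  have "int (ord (x r)) dvd int m" using assms(2)[OF x(2)] x(2) by (simp add: pow_eq_id)
  moreover have "int m dvd f r - e r" using Suc.prems(2)[of r, symmetric] by (simp add: mod_eq_dvd_iff)
  ultimately have "x r [^] e r = x r [^] f r" using x(2) by (metis dvd_trans int_pow_eq)
  then show ?case using Suc x(1) by simp
qed simp

text \<open>The generators are paired up, and the Chinese remainder theorem supplies exponents that
  act as prescribed on both factors at once. So \<open>r\<close> generators suffice, instead of
  \<open>2 * r\<close>.\<close>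

lemma rank_group_DirProd:
  assumes G: "rank_group r m G" and H: "rank_group r n H" and mn: "coprime m n"
  shows "rank_group r (m * n) (G \<times>\<times> H)"
proof -
  interpret G: comm_group G using G by (simp add: rank_group_def)
  interpret H: comm_group H using H by (simp add: rank_group_def)
  obtain x where x: "x \<in> {..<r} \<rightarrow> carrier G" "words G x r = carrier G"
    using G unfolding rank_group_iff by blast
  obtain y where y: "y \<in> {..<r} \<rightarrow> carrier H" "words H y r = carrier H"
    using H unfolding rank_group_iff by blast
  have m: "g [^]\<^bsub>G\<^esub> m = \<one>\<^bsub>G\<^esub>" if "g \<in> carrier G" for g
    using G.pow_order_eq_1[OF that] G by (simp add: rank_group_def)
  have n: "g [^]\<^bsub>H\<^esub> n = \<one>\<^bsub>H\<^esub>" if "g \<in> carrier H" for g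
    using H.pow_order_eq_1[OF that] H by (simp add: rank_group_def)
  obtain u v where uv: "u * int m + v * int n = 1"
    using bezout_int[of "int m" "int n"] mn by (auto simp: coprime_iff_gcd_eq_1)
  have xy: "(\<lambda>i. (x i, y i)) \<in> {..<r} \<rightarrow> carrier (G \<times>\<times> H)" using x y by auto
  have "carrier (G \<times>\<times> H) \<subseteq> words (G \<times>\<times> H) (\<lambda>i. (x i, y i)) r"
  proof
    fix z assume "z \<in> carrier (G \<times>\<times> H)"
    then obtain a b where z: "z = (a, b)" "a \<in> words G x r" "b \<in> words H y r" using x y by auto
    then obtain e f where ef: "a = word G x e r" "b = word H y f r" by (auto simp: words_def)
    define c where "c i = e i * (v * int n) + f i * (u * int m)" for i
    have vn: "v * int n = 1 - u * int m" and um: "u * int m = 1 - v * int n" using uv by simp_all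
    have "c i - e i = int m * ((f i - e i) * u)" for i unfolding c_def vn by (simp add: algebra_simps)
    then have "c i mod int m = e i mod int m" for i by (simp add: mod_eq_dvd_iff)
    then have "word G x c r = a" unfolding ef by (intro G.word_cong_exponent[OF x(1) m]) auto
    moreover have "c i - f i = int n * ((e i - f i) * v)" for i
      unfolding c_def um by (simp add: algebra_simps)
    then have "c i mod int n = f i mod int n" for i by (simp add: mod_eq_dvd_iff)
    then have "word H y c r = b" unfolding ef by (intro H.word_cong_exponent[OF y(1) n]) auto
    ultimately show "z \<in> words (G \<times>\<times> H) (\<lambda>i. (x i, y i)) r"
      using word_DirProd[OF G.comm_group_axioms H.comm_group_axioms x(1) y(1), of c]
      unfolding z words_def by (metis rangeI)
  qed
  then have "words (G \<times>\<times> H) (\<lambda>i. (x i, y i)) r = carrier (G \<times>\<times> H)"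
    using comm_group.words_closed[OF comm_group_DirProd[OF G.comm_group_axioms H.comm_group_axioms] xy] by blast
  then show ?thesis
    using xy G H comm_group_DirProd[of G H] unfolding rank_group_iff
    by (auto simp: Coset.order_def card_cartesian_product)
qed

text \<open>The product of representatives lives on pairs, and \<open>iso_class\<close> brings it
  back to \<open>nat\<close>. Independence of the choice, for finite groups, is
  \<open>iso_class_prod_eq\<close>.\<close>

definition iso_class_prod :: "nat monoid set \<Rightarrow> nat monoid set \<Rightarrow> nat monoid set" where
  "iso_class_prod c d = iso_class ((SOME G. G \<in> c) \<times>\<times> (SOME H. H \<in> d))"

lemma iso_class_prod_eq:
  assumes "group G" "group H" "finite (carrier G)" "finite (carrier H)"
  shows "iso_class_prod (iso_class G) (iso_class H) = iso_class (G \<times>\<times> H)"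
proof -
  have rep: "group (SOME G'. G' \<in> iso_class K) \<and> K \<cong> (SOME G'. G' \<in> iso_class K)"
    if "group K" "finite (carrier K)" for K :: "('x, 'y) monoid_scheme"
  proof -
    have "\<exists>G'. G' \<in> iso_class K" using ex_nat_copy[OF that] by (auto simp: iso_class_def)
    then have "(SOME G'. G' \<in> iso_class K) \<in> iso_class K" by (rule someI_ex)
    then show ?thesis by (simp add: iso_class_def)
  qed
  define G' where "G' = (SOME G'. G' \<in> iso_class G)"
  define H' where "H' = (SOME H'. H' \<in> iso_class H)"
  have *: "group G'" "G \<cong> G'" "group H'" "H \<cong> H'"
    using rep[OF assms(1,3)] rep[OF assms(2,4)] by (simp_all add: G'_def H'_def)
  have "iso_class (G \<times>\<times> H) = iso_class (G' \<times>\<times> H')"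
    using * assms(1,2) by (intro iso_class_eqI DirProd_group DirProd_iso_cong)
  then show ?thesis by (simp add: iso_class_prod_def G'_def H'_def)
qed

lemma rank_group_groupD:
  assumes "rank_group r n G"
  shows "comm_group G" "group G" "finite (carrier G)"
  using assms by (auto simp: rank_group_def comm_group_def)

lemma rank_group_pow_eq_one:
  assumes "rank_group r d G" "d dvd m" "g \<in> carrier G"
  shows "g [^]\<^bsub>G\<^esub> m = \<one>\<^bsub>G\<^esub>"
proof -
  interpret group G by (rule rank_group_groupD(2)[OF assms(1)])
  have "ord g dvd m" using ord_dvd_group_order[OF assms(3)] assms(1,2) by (auto simp: rank_group_def)
  then show ?thesis using assms(3) by (simp add: pow_eq_id)
qed

text \<open>The orders on the two sides may differ as long as they divide the same \<open>m\<close>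
  or \<open>n\<close>. This form serves the subgroups, whose orders are not known to agree
  beforehand.\<close>

lemma coprime_DirProd_iso:
  assumes G: "rank_group r a G1" "rank_group r b G2" and H: "rank_group r a' H1" "rank_group r b' H2"
    and dvd: "a dvd m" "a' dvd m" "b dvd n" "b' dvd n" and mn: "coprime m n"
    and iso: "G1 \<times>\<times> G2 \<cong> H1 \<times>\<times> H2"
  shows "G1 \<cong> H1" "G2 \<cong> H2"
proof -
  note g = rank_group_groupD[OF G(1)] rank_group_groupD[OF G(2)]
    rank_group_groupD[OF H(1)] rank_group_groupD[OF H(2)]
  note p = rank_group_pow_eq_one[OF G(1) dvd(1)] rank_group_pow_eq_one[OF H(1) dvd(2)]
    rank_group_pow_eq_one[OF G(2) dvd(3)] rank_group_pow_eq_one[OF H(2) dvd(4)]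
  show "G1 \<cong> H1"
    by (rule DirProd_cancel[of G1 G2 H1 H2 m n]) (use g p mn iso in auto)
  have "G2 \<times>\<times> G1 \<cong> H2 \<times>\<times> H1"
    using iso_trans[OF iso_trans[OF DirProd_commute_iso iso] DirProd_commute_iso] .
  then show "G2 \<cong> H2"
    by (intro DirProd_cancel[of G2 G1 H2 H1 n m]) (use g p mn in \<open>auto simp: coprime_commute\<close>)
qed

lemma DirProd_carrier_update:
  "G\<lparr>carrier := K\<rparr> \<times>\<times> H\<lparr>carrier := L\<rparr> = (G \<times>\<times> H)\<lparr>carrier := K \<times> L\<rparr>"
  by (simp add: DirProd_def)

text \<open>Injectivity is cancellation, applied once to the groups and once to the subgroups. For
  surjectivity a group of order \<open>m * n\<close> is split into torsion parts; its subgroup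
  splits along them, as the torsion of the subgroup is its intersection with these parts.\<close>

lemma class_pairs_bij:
  assumes mn: "coprime m n" and pos: "m > 0" "n > 0"
  shows "bij_betw (\<lambda>((c, d), (c', d')). (iso_class_prod c c', iso_class_prod d d'))
    (class_pairs r m \<times> class_pairs r n) (class_pairs r (m * n))"
    (is "bij_betw ?\<Phi> (?P m \<times> ?P n) _")
proof (rule bij_betw_imageI)
  have \<Phi>: "?\<Phi> ((iso_class G, iso_class (G\<lparr>carrier := K\<rparr>)), (iso_class H, iso_class (H\<lparr>carrier := L\<rparr>)))
      = (iso_class (G \<times>\<times> H), iso_class (G\<lparr>carrier := K\<rparr> \<times>\<times> H\<lparr>carrier := L\<rparr>))"
    if "rank_group r m G" "subgroup K G" "rank_group r n H" "subgroup L H"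
    for G H :: "nat monoid" and K L
    using rank_group_groupD[OF that(1)] rank_group_groupD[OF that(3)]
      rank_group_groupD[OF rank_group_subgroup(1)[OF that(1,2)]]
      rank_group_groupD[OF rank_group_subgroup(1)[OF that(3,4)]]
    by (simp only: prod.case iso_class_prod_eq)
  show "inj_on ?\<Phi> (?P m \<times> ?P n)"
  proof (rule inj_onI)
    fix z w assume "z \<in> ?P m \<times> ?P n" "w \<in> ?P m \<times> ?P n" and eq: "?\<Phi> z = ?\<Phi> w"
    then obtain G H G' H' :: "nat monoid" and K L K' L' where
      z: "z = ((iso_class G, iso_class (G\<lparr>carrier := K\<rparr>)), (iso_class H, iso_class (H\<lparr>carrier := L\<rparr>)))"
        "rank_group r m G" "subgroup K G" "rank_group r n H" "subgroup L H" and
      w: "w = ((iso_class G', iso_class (G'\<lparr>carrier := K'\<rparr>)), (iso_class H', iso_class (H'\<lparr>carrier := L'\<rparr>)))"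
        "rank_group r m G'" "subgroup K' G'" "rank_group r n H'" "subgroup L' H'"
      unfolding class_pairs_def by blast
    note zs = rank_group_subgroup[OF z(2,3)] rank_group_subgroup[OF z(4,5)]
    note ws = rank_group_subgroup[OF w(2,3)] rank_group_subgroup[OF w(4,5)]
    have e: "iso_class (G \<times>\<times> H) = iso_class (G' \<times>\<times> H')"
      "iso_class (G\<lparr>carrier := K\<rparr> \<times>\<times> H\<lparr>carrier := L\<rparr>) = iso_class (G'\<lparr>carrier := K'\<rparr> \<times>\<times> H'\<lparr>carrier := L'\<rparr>)"
      using eq unfolding z(1) w(1) \<Phi>[OF z(2-5)] \<Phi>[OF w(2-5)] by (simp_all only: prod.inject)
    have "G \<times>\<times> H \<cong> G' \<times>\<times> H'"
      using e(1) rank_group_groupD[OF z(2)] rank_group_groupD[OF z(4)] rank_group_groupD[OF w(2)] rank_group_groupD[OF w(4)]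
      by (subst (asm) iso_class_eq_iff) (auto intro: DirProd_group)
    note 1 = coprime_DirProd_iso[OF z(2,4) w(2,4) dvd_refl dvd_refl dvd_refl dvd_refl mn this]
    have "G\<lparr>carrier := K\<rparr> \<times>\<times> H\<lparr>carrier := L\<rparr> \<cong> G'\<lparr>carrier := K'\<rparr> \<times>\<times> H'\<lparr>carrier := L'\<rparr>"
    proof (rule iso_class_eq_iff[THEN iffD1, OF _ _ _ e(2)])
      show "group (G\<lparr>carrier := K\<rparr> \<times>\<times> H\<lparr>carrier := L\<rparr>)" "group (G'\<lparr>carrier := K'\<rparr> \<times>\<times> H'\<lparr>carrier := L'\<rparr>)"
        by (intro DirProd_group rank_group_groupD(2)[OF zs(1)] rank_group_groupD(2)[OF zs(3)]
            rank_group_groupD(2)[OF ws(1)] rank_group_groupD(2)[OF ws(3)])+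
      show "finite (carrier (G\<lparr>carrier := K\<rparr> \<times>\<times> H\<lparr>carrier := L\<rparr>))"
        using rank_group_groupD(3)[OF zs(1)] rank_group_groupD(3)[OF zs(3)] by simp
    qed
    note 2 = coprime_DirProd_iso[OF zs(1,3) ws(1,3) zs(2) ws(2) zs(4) ws(4) mn this]
    show "z = w"
      unfolding z(1) w(1) prod.inject
      using 1 2 rank_group_groupD(2)[OF z(2)] rank_group_groupD(2)[OF z(4)]
        rank_group_groupD(2)[OF w(2)] rank_group_groupD(2)[OF w(4)]
        rank_group_groupD(2)[OF zs(1)] rank_group_groupD(2)[OF zs(3)]
        rank_group_groupD(2)[OF ws(1)] rank_group_groupD(2)[OF ws(3)]
      by (intro conjI iso_class_eqI)
  qed
  show "?\<Phi> ` (?P m \<times> ?P n) = class_pairs r (m * n)"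
  proof (intro equalityI subsetI)
    fix z assume "z \<in> ?\<Phi> ` (?P m \<times> ?P n)"
    then obtain G H :: "nat monoid" and K L where z: "rank_group r m G" "subgroup K G" "rank_group r n H" "subgroup L H"
      and z_eq: "z = ?\<Phi> ((iso_class G, iso_class (G\<lparr>carrier := K\<rparr>)), (iso_class H, iso_class (H\<lparr>carrier := L\<rparr>)))"
      unfolding class_pairs_def by blast
    have "subgroup (K \<times> L) (G \<times>\<times> H)"
      using z rank_group_groupD(2) by (intro DirProd_subgroups) blast+
    from class_pairs_memI[OF rank_group_DirProd[OF z(1,3) mn] this]
    show "z \<in> class_pairs r (m * n)"
      unfolding z_eq \<Phi>[OF z] DirProd_carrier_update .
  next
    fix z assume "z \<in> class_pairs r (m * n)"
    then obtain G :: "nat monoid" and K where z: "z = (iso_class G, iso_class (G\<lparr>carrier := K\<rparr>))"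
      "rank_group r (m * n) G" "subgroup K G" unfolding class_pairs_def by blast
    note G = rank_group_groupD[OF z(2)]
    interpret G: comm_group G by (rule G(1))
    have oG: "order G = m * n" using z(2) by (simp add: rank_group_def)
    define T where "T k = torsion G k" for k
    have T: "subgroup (T k) G" for k unfolding T_def by (rule G.subgroup_torsion)
    have cT: "card (T m) = m" "card (T n) = n"
      unfolding T_def using G.card_torsion[OF G(3) oG mn pos] by auto
    define K' where "K' k = K \<inter> T k" for k
    have K'_G: "subgroup (K' k) G" for k
      unfolding K'_def by (rule G.subgroups_Inter_pair[OF z(3) T])
    have K'_T: "subgroup (K' k) (G\<lparr>carrier := T k\<rparr>)" for k
      by (rule G.subgroup_incl[OF K'_G T]) (simp add: K'_def)
    have tors: "torsion (G\<lparr>carrier := K\<rparr>) k = K' k" for k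
      using subgroup.subset[OF z(3)]
      by (auto simp: torsion_def K'_def T_def simp flip: G.nat_pow_consistent)
    interpret K: comm_group "G\<lparr>carrier := K\<rparr>" by (rule G.subgroup_comm_group[OF z(3)])
    have expG: "g [^]\<^bsub>G\<^esub> (m * n) = \<one>\<^bsub>G\<^esub>" if "g \<in> carrier G" for g
      using rank_group_pow_eq_one[OF z(2) dvd_refl that] .
    have "G\<lparr>carrier := T m\<rparr> \<times>\<times> G\<lparr>carrier := T n\<rparr> \<cong> G"
      using G.torsion_decomposition[OF mn expG] unfolding T_def is_iso_def by blast
    then have 1: "iso_class (G\<lparr>carrier := T m\<rparr> \<times>\<times> G\<lparr>carrier := T n\<rparr>) = iso_class G"
      by (intro iso_class_eqI DirProd_group G.subgroup_imp_group T G(2))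
    have expK: "g [^]\<^bsub>G\<lparr>carrier := K\<rparr>\<^esub> (m * n) = \<one>\<^bsub>G\<lparr>carrier := K\<rparr>\<^esub>" if "g \<in> carrier (G\<lparr>carrier := K\<rparr>)" for g
      using rank_group_pow_eq_one[OF rank_group_subgroup[OF z(2,3)] that] .
    have "G\<lparr>carrier := K' m\<rparr> \<times>\<times> G\<lparr>carrier := K' n\<rparr> \<cong> G\<lparr>carrier := K\<rparr>"
      using K.torsion_decomposition[OF mn expK] unfolding tors is_iso_def by auto
    then have 2: "iso_class (G\<lparr>carrier := K' m\<rparr> \<times>\<times> G\<lparr>carrier := K' n\<rparr>) = iso_class (G\<lparr>carrier := K\<rparr>)"
      by (intro iso_class_eqI DirProd_group G.subgroup_imp_group K'_G z(3))
    have R: "rank_group r m (G\<lparr>carrier := T m\<rparr>)" "rank_group r n (G\<lparr>carrier := T n\<rparr>)"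
      using rank_group_subgroup(1)[OF z(2) T[of m]] rank_group_subgroup(1)[OF z(2) T[of n]] cT by auto
    \<comment> \<open>The repeated carrier update collapses, so \<open>K' k\<close> inside
      \<open>T k\<close> is the same group as \<open>K' k\<close> inside \<open>G\<close>.\<close>
    define w where "w = ((iso_class (G\<lparr>carrier := T m\<rparr>), iso_class (G\<lparr>carrier := T m\<rparr>\<lparr>carrier := K' m\<rparr>)),
      (iso_class (G\<lparr>carrier := T n\<rparr>), iso_class (G\<lparr>carrier := T n\<rparr>\<lparr>carrier := K' n\<rparr>)))"
    have "w \<in> ?P m \<times> ?P n"
      unfolding w_def by (intro SigmaI class_pairs_memI R K'_T)
    moreover have "?\<Phi> w = z"
      unfolding w_def \<Phi>[OF R(1) K'_T R(2) K'_T] z(1) by (simp add: 1 2)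
    ultimately show "z \<in> ?\<Phi> ` (?P m \<times> ?P n)" by blast
  qed
qed

section \<open>Cyclic groups\<close>

lemma rank_group_integer_mod_group:
  assumes "n > 0" "r \<ge> 1"
  shows "rank_group r n (integer_mod_group n)"
proof -
  let ?Z = "integer_mod_group n"
  have fin: "finite (carrier ?Z)" using assms by (simp add: carrier_integer_mod_group)
  have "words ?Z (\<lambda>_. 1 mod int n) 1 = carrier ?Z"
  proof (intro equalityI subsetI)
    fix a assume "a \<in> carrier ?Z"
    then have "a = word ?Z (\<lambda>_. 1 mod int n) (\<lambda>_. a) 1"
      using assms(1) by (simp add: int_pow_integer_mod_group carrier_integer_mod_group mod_mult_right_eq)
    then show "a \<in> words ?Z (\<lambda>_. 1 mod int n) 1" unfolding words_def by blast
  qed (use assms(1) in \<open>auto simp: words_def carrier_integer_mod_group\<close>)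
  moreover have "(\<lambda>_. 1 mod int n) \<in> {..<1} \<rightarrow> carrier ?Z"
    using assms(1) by (auto simp: carrier_integer_mod_group)
  ultimately have "group_rank ?Z \<le> 1"
    using group_rank_le_iff[OF abelian_integer_mod_group fin] by blast
  then show ?thesis
    using fin assms by (simp add: rank_group_def Coset.order_def carrier_integer_mod_group)
qed

text \<open>The \<open>d\<close>-torsion consists of the multiples of \<open>n / d\<close>.\<close>

lemma card_torsion_integer_mod_group:
  assumes "n > 0" "d dvd n"
  shows "card (torsion (integer_mod_group n) d) = d"
proof -
  obtain q where q: "n = d * q" using assms(2) by blast
  have pos: "d > 0" "q > 0" using assms(1) q by auto
  have "torsion (integer_mod_group n) d = (\<lambda>k. int q * k) ` {0..<int d}"
  proof (intro equalityI subsetI)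
    fix a assume "a \<in> torsion (integer_mod_group n) d"
    then have a: "0 \<le> a" "a < int n" "int d * a mod int n = 0"
      using assms(1) by (auto simp: torsion_def carrier_integer_mod_group)
    then have "int d * int q dvd int d * a" using q by (simp add: dvd_eq_mod_eq_0)
    then have "int q dvd a" using pos by simp
    then obtain k where k: "a = int q * k" by blast
    have "0 \<le> k" using a(1) pos unfolding k by (simp add: zero_le_mult_iff)
    moreover have "k < int d" using a(2) pos unfolding k q by (simp add: mult.commute)
    ultimately show "a \<in> (\<lambda>k. int q * k) ` {0..<int d}" using k by auto
  next
    fix a assume "a \<in> (\<lambda>k. int q * k) ` {0..<int d}"
    then obtain k where k: "a = int q * k" "0 \<le> k" "k < int d" by force
    have "a < int n" using k pos by (simp add: q mult.commute)
    moreover have "int d * a mod int n = 0" by (simp add: k q)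
    ultimately show "a \<in> torsion (integer_mod_group n) d"
      using k assms(1) by (simp add: torsion_def carrier_integer_mod_group)
  qed
  moreover have "inj_on (\<lambda>k. int q * k) {0..<int d}" using pos by (auto simp: inj_on_def)
  ultimately show ?thesis by (simp add: card_image)
qed

lemma card_divisors_le_card_class_pairs:
  assumes "n > 0" "r \<ge> 1"
  shows "card {d. d dvd n} \<le> card (class_pairs r n)"
proof (rule card_inj_on_le)
  let ?Z = "integer_mod_group n"
  interpret Z: comm_group ?Z by simp
  note R = rank_group_integer_mod_group[OF assms]
  let ?f = "\<lambda>d. (iso_class ?Z, iso_class (?Z\<lparr>carrier := torsion ?Z d\<rparr>))"
  show "?f ` {d. d dvd n} \<subseteq> class_pairs r n"
    using class_pairs_memI[OF R Z.subgroup_torsion] by blast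
  show "inj_on ?f {d. d dvd n}"
  proof (rule inj_onI)
    fix d d' assume d: "d \<in> {d. d dvd n}" "d' \<in> {d. d dvd n}" and "?f d = ?f d'"
    then have "iso_class (?Z\<lparr>carrier := torsion ?Z d\<rparr>) = iso_class (?Z\<lparr>carrier := torsion ?Z d'\<rparr>)" by simp
    moreover note T = rank_group_groupD[OF rank_group_subgroup(1)[OF R Z.subgroup_torsion]]
    ultimately have "?Z\<lparr>carrier := torsion ?Z d\<rparr> \<cong> ?Z\<lparr>carrier := torsion ?Z d'\<rparr>"
      using iso_class_eq_iff[OF T(2) T(2) T(3)] by blast
    then have "card (torsion ?Z d) = card (torsion ?Z d')" using iso_same_card by fastforce
    then show "d = d'" using d card_torsion_integer_mod_group[OF assms(1)] by simp
  qed
  show "finite (class_pairs r n)" by (rule class_pairs_bound[OF assms(1)])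
qed

text \<open>The one-generator case of \<open>independent_words_iso\<close>, where independence is
  automatic.\<close>

lemma cyclic_groups_iso:
  assumes "comm_group G" "comm_group H" "finite (carrier G)" "finite (carrier H)"
    and "g \<in> carrier G" "group.ord G g = order G" "h \<in> carrier H" "group.ord H h = order H"
    and "order G = order H"
  shows "G \<cong> H"
proof (rule independent_words_iso[OF assms(1,2)])
  have ind: "independent K (\<lambda>_. k) 1" and gen: "words K (\<lambda>_. k) 1 = carrier K"
    if K: "comm_group K" "finite (carrier K)" and k: "k \<in> carrier K" "group.ord K k = order K"
    for K :: "('x, 'y) monoid_scheme" and k
  proof -
    interpret comm_group K by fact
    show "independent K (\<lambda>_. k) 1" using k(1) by (simp add: independent_def)
    have "words K (\<lambda>_. k) 1 = generate K {k}"
      using k(1) by (auto simp: words_def generate_pow)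
    also have "\<dots> = carrier K"
      using generate_pow_card[OF k(1)] generate_incl[of "{k}"] k K(2)
      by (intro card_subset_eq) (auto simp: Coset.order_def)
    finally show "words K (\<lambda>_. k) 1 = carrier K" .
  qed
  show "independent G (\<lambda>_. g) 1" "words G (\<lambda>_. g) 1 = carrier G"
    by (rule ind[OF assms(1,3,5,6)], rule gen[OF assms(1,3,5,6)])
  show "independent H (\<lambda>_. h) 1" "words H (\<lambda>_. h) 1 = carrier H"
    by (rule ind[OF assms(2,4,7,8)], rule gen[OF assms(2,4,7,8)])
qed (use assms in auto)

text \<open>Order 1 is included for the trivial subgroup of a group of prime order; its generator is
  the unit.\<close>

lemma ex_generator_of_prime_order:
  assumes "group G" "finite (carrier G)" "order G = 1 \<or> prime (order G)"
  shows "\<exists>g\<in>carrier G. group.ord G g = order G"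
proof (cases "order G = 1")
  case True
  interpret group G by fact
  show ?thesis using True by (intro bexI[of _ "\<one>\<^bsub>G\<^esub>"]) auto
next
  case False
  interpret group G by fact
  have p: "prime (order G)" using False assms(3) by blast
  then have "card (carrier G) > 1" using prime_gt_1_nat by (auto simp: Coset.order_def)
  then have "\<not> carrier G \<subseteq> {\<one>\<^bsub>G\<^esub>}" using card_mono[of "{\<one>\<^bsub>G\<^esub>}" "carrier G"] by auto
  then obtain g where g: "g \<in> carrier G" "g \<noteq> \<one>\<^bsub>G\<^esub>" by blast
  then have "ord g \<noteq> 1" using ord_eq_1[OF g(1)] by blast
  then have "ord g = order G" using ord_dvd_group_order[OF g(1)] p unfolding prime_nat_iff by blast
  then show ?thesis using g by blast
qed

text \<open>The group is cyclic and a subgroup has order 1 or \<open>p\<close>, which leaves two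
  candidates; the two divisors of \<open>p\<close> show that both occur.\<close>

lemma card_class_pairs_prime:
  assumes "prime p" "r \<ge> 1"
  shows "card (class_pairs r p) = 2"
proof (rule antisym)
  define c where "c k = iso_class (integer_mod_group k)" for k
  have cls: "iso_class G = c (order G)" if G0: "rank_group r k G" "order G = 1 \<or> prime (order G)" for G :: "nat monoid" and k
  proof -
    note G = rank_group_groupD[OF G0(1)]
    let ?Z = "integer_mod_group (order G)"
    have pos: "order G > 0" using G0(2) prime_gt_0_nat by auto
    have oZ: "order ?Z = order G" "finite (carrier ?Z)"
      using pos by (auto simp: Coset.order_def[of ?Z] carrier_integer_mod_group)
    obtain g where g: "g \<in> carrier G" "group.ord G g = order G"
      using ex_generator_of_prime_order[OF G(2,3) G0(2)] by blast
    obtain h where h: "h \<in> carrier ?Z" "group.ord ?Z h = order ?Z"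
      using ex_generator_of_prime_order[of ?Z] oZ G0(2) by auto
    have "G \<cong> ?Z"
      by (rule cyclic_groups_iso[OF G(1) abelian_integer_mod_group G(3) oZ(2) g h oZ(1)[symmetric]])
    then show ?thesis unfolding c_def by (intro iso_class_eqI G(2)) simp_all
  qed
  have "class_pairs r p \<subseteq> {(c p, c 1), (c p, c p)}"
  proof
    fix z assume "z \<in> class_pairs r p"
    then obtain G :: "nat monoid" and K where z: "z = (iso_class G, iso_class (G\<lparr>carrier := K\<rparr>))"
      "rank_group r p G" "subgroup K G" unfolding class_pairs_def by blast
    have "iso_class G = c p" using cls[OF z(2)] z(2) assms(1) by (simp add: rank_group_def)
    moreover have "card K = 1 \<or> card K = p"
      using rank_group_subgroup(2)[OF z(2,3)] assms(1) by (simp add: prime_nat_iff)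
    then have "iso_class (G\<lparr>carrier := K\<rparr>) = c (card K)"
      using cls[OF rank_group_subgroup(1)[OF z(2,3)]] assms(1) by (auto simp: Coset.order_def)
    ultimately have "z = (c p, c 1) \<or> z = (c p, c p)"
      using \<open>card K = 1 \<or> card K = p\<close> unfolding z(1) by metis
    then show "z \<in> {(c p, c 1), (c p, c p)}" by blast
  qed
  then have "card (class_pairs r p) \<le> card {(c p, c 1), (c p, c p)}" by (intro card_mono) auto
  also have "\<dots> \<le> 2" by (simp add: card_insert_if)
  finally show "card (class_pairs r p) \<le> 2" .
  have "{d. d dvd p} = {1, p}" using assms(1) by (auto simp: prime_nat_iff)
  moreover have "p \<noteq> 1" using assms(1) by auto
  ultimately have "card {d. d dvd p} = 2" by simp
  then show "2 \<le> card (class_pairs r p)"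
    using card_divisors_le_card_class_pairs[of p r] assms prime_gt_0_nat by auto
qed

text \<open>The upper and the lower bound coincide, because 1 has a single divisor.\<close>

lemma card_class_pairs_1:
  assumes "r \<ge> 1"
  shows "card (class_pairs r 1) = 1"
  using class_pairs_bound[of 1 r] card_divisors_le_card_class_pairs[of 1 r] assms by simp

lemma card_divisors_prime_power:
  assumes "prime (p::nat)"
  shows "card {d. d dvd p ^ k} = k + 1"
proof -
  have "{d. d dvd p ^ k} = (\<lambda>i. p ^ i) ` {..k}"
    using assms by (auto simp: divides_primepow_nat)
  moreover have "inj_on (\<lambda>i. p ^ i) {..k}"
    using prime_gt_1_nat[OF assms] by (auto simp: inj_on_def)
  ultimately show ?thesis by (simp add: card_image)
qed

theorem corollary3:
  fixes r :: nat
  assumes "r \<ge> 1"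
  shows "\<exists>C :: real.
    (\<lambda>x :: real. \<Sum>n = 1..nat \<lfloor>x\<rfloor>. real (subgroup_class_total r n)) \<sim>[at_top] (\<lambda>x. C * x * ln x)"
proof -
  define a where "a n = real (card (class_pairs r n))" for n
  have "multiplicative a"
    using card_class_pairs_1[OF assms] bij_betw_same_card[OF class_pairs_bij]
    by (auto simp: multiplicative_def a_def card_cartesian_product simp flip: of_nat_mult)
  moreover have "a p = 2" if "prime p" for p
    using card_class_pairs_prime[OF that assms] by (simp add: a_def)
  \<comment> \<open>As \<open>p^k\<close> has \<open>k + 1\<close> divisors, the general bound
    becomes a polynomial in \<open>k\<close> of degree \<open>2 * r\<close>, uniform in
    \<open>p\<close>.\<close>
  moreover have "\<bar>a (p ^ k)\<bar> \<le> (real k + 1) ^ (2 * r)" if "prime p" for p k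
  proof -
    have "card (class_pairs r (p ^ k)) \<le> (k + 1) ^ (2 * r)"
      using class_pairs_bound(2)[of "p ^ k" r] card_divisors_prime_power[OF that, of k]
        prime_gt_0_nat[OF that] by simp
    then have "real (card (class_pairs r (p ^ k))) \<le> real ((k + 1) ^ (2 * r))" by (rule of_nat_mono)
    then show ?thesis by (simp add: a_def add.commute)
  qed
  moreover have "a n \<ge> real (card {d. d dvd n})" if "n > 0" for n
    using card_divisors_le_card_class_pairs[OF that assms] by (simp add: a_def)
  ultimately have "\<exists>C. (\<lambda>x :: real. \<Sum>n = 1..nat \<lfloor>x\<rfloor>. a n) \<sim>[at_top] (\<lambda>x. C * x * ln x)"
    by (rule multiplicative_summatory_asymp)
  moreover have "(\<Sum>n = 1..N. a n) = (\<Sum>n = 1..N. real (subgroup_class_total r n))" for N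
    by (intro sum.cong) (auto simp: a_def subgroup_class_total_eq_card)
  ultimately show ?thesis by simp
qed

end
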